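(* Consider the problem $\min_{x\in\mathbb{R}^n} f(x):=\sum_{i=1}^m f_i(x)$ subject to $A_ix=b_i$ for all $i\in[m]$ and $x_j\ge0$ for $j\in\mathcal{J}\subseteq[n]$, where $A_i\in\mathbb{R}^{m_i\times n}$ and $b_i\in\mathbb{R}^{m_i}$. Assume the feasible set is nonempty and that each $f_i:\mathbb{R}^n\to\mathbb{R}$ is $\mu_f$-strongly convex and $L_f$-smooth; let $x^*$ be the optimal solution of this problem. Define, for $i\in[m]$, $$g_i(x):=\tfrac12\|A_ix-b_i\|_2^2+\tfrac1{2m}\sum_{j\in\mathcal{J}}\max\{0,-x_j\}^2 .$$ Let $\mathbf{R},\mathbf{C}$ satisfy the mixing-matrix assumption, let the step-sizes and regularization parameters satisfy the update-rule assumption with $a:=0.2$ and $b:=0.2-\epsilon/3$, where $\epsilon>0$ is a sufficiently small scalar, and let $(\mathbf{x}_k,\mathbf{y}_k)_{k\ge0}$ be generated by the iteratively regularized push-pull algorithm with these $f_i,g_i$, with $\bar x_k=\frac1m u^T\mathbf{x}_k$ and $\bar y_k=\frac1m\mathbf{1}^T\mathbf{y}_k$ (all as described in the context). Then $\lim_{k\to\infty}\bar x_k=x^*$, and for all sufficiently large $k$: (a) $\|\mathbf{x}_{k+1}-\mathbf{1}\bar x_{k+1}\|_{\mathbf{R}}=\mathcal{O}\left(1/k^{0.6+\epsilon/3}\right)$ and $\|\mathbf{y}_{k+1}-\nu\bar y_{k+1}\|_{\mathbf{C}}=\mathcal{O}\left(1/k^{0.6+\epsilon/3}\right)$. (b)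 $f(\bar x_k)-f(x^* )=\mathcal{O}\left(1/k^{1-\epsilon}\right)$. (c) $\|\mathbf{A}\bar x_k-\mathbf{b}\|_2^2=\mathcal{O}\left(1/k^{0.2-\epsilon/3}\right)$, where $\mathbf{A}=[A_1^T,\dots,A_m^T]^T$ and $\mathbf{b}=[b_1^T,\dots,b_m^T]^T$.
   Context: Conventions. $\mu_f,L_f>0$. A differentiable $h$ is $\mu$-strongly convex if $(\nabla h(x)-\nabla h(y))^T(x-y)\ge\mu\|x-y\|_2^2$ for all $x,y$, and $L$-smooth if $\|\nabla h(x)-\nabla h(y)\|_2\le L\|x-y\|_2$ for all $x,y$. $[m]=\{1,\dots,m\}$ and $\mathbf{1}\in\mathbb{R}^m$ is the all-ones vector. Vectors of $\mathbb{R}^n$ are identified with $1\times n$ rows when needed ($\bar x_k$ is treated as a column vector in $\mathbf{A}\bar x_k$). Mixing-matrix assumption. $\mathbf{R},\mathbf{C}\in\mathbb{R}^{m\times m}$ are nonnegative with strictly positive diagonals, $\mathbf{R}\mathbf{1}=\mathbf{1}$ and $\mathbf{1}^T\mathbf{C}=\mathbf{1}^T$. For a nonnegative $\mathbf{B}\in\mathbb{R}^{m\times m}$, $\mathcal{G}_{\mathbf{B}}$ is the digraph on $[m]$ with edge $(j,i)$ (from parent $j$ to child $i$) iff $B_{ij}>0$, and $\mathcal{R}_{\mathbf{B}}$ is the set of roots of all possible directed spanning trees of $\mathcal{G}_{\mathbf{B}}$. It is assumed that $\mathcal{R}_{\mathbf{R}}\cap\mathcal{R}_{\mathbf{C}^T}\ne\emptyset$.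 Under this assumption there are a unique nonnegative $u\in\mathbb{R}^m$ with $u^T\mathbf{R}=u^T$, $u^T\mathbf{1}=m$, and a unique nonnegative $\nu\in\mathbb{R}^m$ with $\mathbf{C}\nu=\nu$, $\mathbf{1}^T\nu=m$. Algorithm (iteratively regularized push-pull). For $\mathbf{x}\in\mathbb{R}^{m\times n}$ with rows $x_1,\dots,x_m$, let $\nabla\mathbf{f}(\mathbf{x})\in\mathbb{R}^{m\times n}$ have $i$-th row $\nabla f_i(x_i)^T$, and similarly $\nabla\mathbf{g}(\mathbf{x})$. Given step-sizes $\gamma_{i,k}\ge0$, $\boldsymbol{\gamma}_k=\mathrm{diag}(\gamma_{1,k},\dots,\gamma_{m,k})$, and $\lambda_k>0$, take $\mathbf{x}_0\in\mathbb{R}^{m\times n}$ arbitrary, $\mathbf{y}_0=\nabla\mathbf{g}(\mathbf{x}_0)+\lambda_0\nabla\mathbf{f}(\mathbf{x}_0)$, and for $k\ge0$ $$\mathbf{x}_{k+1}=\mathbf{R}(\mathbf{x}_k-\boldsymbol{\gamma}_k\mathbf{y}_k),\qquad \mathbf{y}_{k+1}=\mathbf{C}\mathbf{y}_k+\nabla\mathbf{g}(\mathbf{x}_{k+1})+\lambda_{k+1}\nabla\mathbf{f}(\mathbf{x}_{k+1})-\nabla\mathbf{g}(\mathbf{x}_k)-\lambda_k\nabla\mathbf{f}(\mathbf{x}_k).$$ Update-rule assumption (exponents $a,b$). With $\hat\gamma_k=\max_{j\in[m]}\gamma_{j,k}$: $\hat\gamma_k=\hat\gamma_0/(k+1)^a$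 and $\lambda_k=\lambda_0/(k+1)^b$, where $\hat\gamma_0,\lambda_0>0$, $0<b<a<1$ and $a+b<1$. Also, for some $\theta>0$, $\alpha_k:=\frac1m u^T\boldsymbol{\gamma}_k\nu\ge\theta\hat\gamma_k$ for all $k\ge0$. Norms. A vector norm $\|\cdot\|$ on $\mathbb{R}^m$ is extended to $W\in\mathbb{R}^{m\times n}$ (columns $W_{\bullet j}$) by $\|W\|=\big\|[\|W_{\bullet1}\|,\dots,\|W_{\bullet n}\|]\big\|_2$; for square $m\times m$ matrices acting from the left the same symbol denotes the induced operator norm. $\|\cdot\|_{\mathbf{R}}$ and $\|\cdot\|_{\mathbf{C}}$ are fixed norms of this kind such that $\sigma_{\mathbf{R}}:=\|\mathbf{R}-\frac1m\mathbf{1}u^T\|_{\mathbf{R}}<1$, $\sigma_{\mathbf{C}}:=\|\mathbf{C}-\frac1m\nu\mathbf{1}^T\|_{\mathbf{C}}<1$, and $\|W\|_2\le\|W\|_{\mathbf{R}}$, $\|W\|_2\le\|W\|_{\mathbf{C}}$ for all $W\in\mathbb{R}^{m\times n}$ (such norms exist).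
   Formalization: Part (b) is proved as an upper bound: f(x̄_k) − f(x* ) ≤ K/k^(1−ε) for large k. The two-sided O fails, e.g. m=n=1, R=C=1, f=(x−1)²/2, A=1, b=0, J empty, where the difference behaves like −λ_k. *)

theory Defs
  imports "HOL-Analysis.Analysis" "HOL-Library.Landau_Symbols"
begin

definition gradient :: "('a::real_inner \<Rightarrow> real) \<Rightarrow> 'a \<Rightarrow> 'a" where
  "gradient h x = (THE D. GDERIV h x :> D)"

definition strongly_convex :: "real \<Rightarrow> ('a::real_inner \<Rightarrow> real) \<Rightarrow> bool" where
  "strongly_convex \<mu> h \<longleftrightarrow> (\<forall>x. h differentiable (at x)) \<and>
     (\<forall>x y. (gradient h x - gradient h y) \<bullet> (x - y) \<ge> \<mu> * (norm (x - y))\<^sup>2)"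

definition L_smooth :: "real \<Rightarrow> ('a::real_inner \<Rightarrow> real) \<Rightarrow> bool" where
  "L_smooth L h \<longleftrightarrow> (\<forall>x. h differentiable (at x)) \<and>
     (\<forall>x y. norm (gradient h x - gradient h y) \<le> L * norm (x - y))"

text \<open>
  The number of rows of \<open>A\<^sub>i\<close> depends on \<open>i\<close>, so the matrix is given by its rows
  \<open>A i r\<close> for \<open>r < d i\<close>, and similarly the right-hand side by \<open>b i r\<close>.
\<close>

definition feasible_set ::
  "('m \<Rightarrow> nat) \<Rightarrow> ('m \<Rightarrow> nat \<Rightarrow> real^'n) \<Rightarrow> ('m \<Rightarrow> nat \<Rightarrow> real) \<Rightarrow> 'n set \<Rightarrow> (real^'n) set" where
  "feasible_set d A b J =
     {x. (\<forall>i. \<forall>r<d i. A i r \<bullet> x = b i r) \<and> (\<forall>j\<in>J. 0 \<le> x $ j)}"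

text \<open>The Euclidean norm of \<open>A\<^sub>i x - b\<^sub>i\<close>, and that of the stacked residual over all \<open>i\<close>.\<close>

definition block_residual ::
  "('m \<Rightarrow> nat) \<Rightarrow> ('m \<Rightarrow> nat \<Rightarrow> real^'n) \<Rightarrow> ('m \<Rightarrow> nat \<Rightarrow> real) \<Rightarrow> 'm \<Rightarrow> real^'n \<Rightarrow> real" where
  "block_residual d A b i x = L2_set (\<lambda>r. A i r \<bullet> x - b i r) {..<d i}"

definition stacked_residual ::
  "('m \<Rightarrow> nat) \<Rightarrow> ('m \<Rightarrow> nat \<Rightarrow> real^'n) \<Rightarrow> ('m \<Rightarrow> nat \<Rightarrow> real) \<Rightarrow> real^'n \<Rightarrow> real" where
  "stacked_residual d A b x =
     L2_set (\<lambda>(i, r). A i r \<bullet> x - b i r) (SIGMA i:UNIV. {..<d i})"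

definition penalty ::
  "('m::finite \<Rightarrow> nat) \<Rightarrow> ('m \<Rightarrow> nat \<Rightarrow> real^'n) \<Rightarrow> ('m \<Rightarrow> nat \<Rightarrow> real) \<Rightarrow> 'n set \<Rightarrow>
   'm \<Rightarrow> real^'n \<Rightarrow> real" where
  "penalty d A b J i x = 1 / 2 * (block_residual d A b i x)\<^sup>2
     + 1 / (2 * real CARD('m)) * (\<Sum>j\<in>J. (max 0 (- (x $ j)))\<^sup>2)"

definition digraph_edges :: "real^'m^'m \<Rightarrow> ('m \<times> 'm) set" where
  "digraph_edges B = {(j, i). B $ i $ j > 0}"

text \<open>Edges point from parent to child, and the spanning tree \<open>T\<close> is directed away from \<open>r\<close>.\<close>

definition directed_spanning_tree :: "('m \<times> 'm) set \<Rightarrow> 'm \<Rightarrow> ('m \<times> 'm) set \<Rightarrow> bool" where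
  "directed_spanning_tree E r T \<longleftrightarrow> T \<subseteq> E \<and>
     (\<forall>p. (p, r) \<notin> T) \<and> (\<forall>v. v \<noteq> r \<longrightarrow> (\<exists>!p. (p, v) \<in> T)) \<and> (\<forall>v. (r, v) \<in> T\<^sup>*)"

definition tree_roots :: "real^'m^'m \<Rightarrow> 'm set" where
  "tree_roots B = {r. \<exists>T. directed_spanning_tree (digraph_edges B) r T}"

definition mixing_matrices :: "real^'m^'m \<Rightarrow> real^'m^'m \<Rightarrow> bool" where
  "mixing_matrices R C \<longleftrightarrow>
     (\<forall>i j. 0 \<le> R $ i $ j \<and> 0 \<le> C $ i $ j) \<and> (\<forall>i. 0 < R $ i $ i \<and> 0 < C $ i $ i) \<and>
     R *v 1 = 1 \<and> 1 v* C = 1 \<and> tree_roots R \<inter> tree_roots (transpose C) \<noteq> {}"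

definition left_eigvec :: "real^'m^'m \<Rightarrow> real^'m \<Rightarrow> bool" where
  "left_eigvec R u \<longleftrightarrow> (\<forall>i. 0 \<le> u $ i) \<and> u v* R = u \<and> u \<bullet> 1 = real CARD('m)"

definition right_eigvec :: "real^'m^'m \<Rightarrow> real^'m \<Rightarrow> bool" where
  "right_eigvec C \<nu> \<longleftrightarrow> (\<forall>i. 0 \<le> \<nu> $ i) \<and> C *v \<nu> = \<nu> \<and> 1 \<bullet> \<nu> = real CARD('m)"

definition diag_mat :: "real^'m \<Rightarrow> real^'m^'m" where
  "diag_mat v = (\<chi> i j. if i = j then v $ i else 0)"

definition outer :: "real^'m \<Rightarrow> real^'n \<Rightarrow> real^'n^'m" where
  "outer v w = (\<chi> i j. v $ i * w $ j)"

definition row_gradients :: "('m \<Rightarrow> real^'n \<Rightarrow> real) \<Rightarrow> real^'n^'m \<Rightarrow> real^'n^'m" where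
  "row_gradients f X = (\<chi> i. gradient (f i) (X $ i))"

definition push_pull ::
  "real^'m^'m \<Rightarrow> real^'m^'m \<Rightarrow> ('m \<Rightarrow> real^'n \<Rightarrow> real) \<Rightarrow> ('m \<Rightarrow> real^'n \<Rightarrow> real) \<Rightarrow>
   (nat \<Rightarrow> real^'m) \<Rightarrow> (nat \<Rightarrow> real) \<Rightarrow> (nat \<Rightarrow> real^'n^'m) \<Rightarrow> (nat \<Rightarrow> real^'n^'m) \<Rightarrow> bool" where
  "push_pull R C f g \<gamma> lam x y \<longleftrightarrow>
     y 0 = row_gradients g (x 0) + lam 0 *\<^sub>R row_gradients f (x 0) \<and>
     (\<forall>k. x (Suc k) = R ** (x k - diag_mat (\<gamma> k) ** y k) \<and>
          y (Suc k) = C ** y k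
            + row_gradients g (x (Suc k)) + lam (Suc k) *\<^sub>R row_gradients f (x (Suc k))
            - row_gradients g (x k) - lam k *\<^sub>R row_gradients f (x k))"

definition max_step :: "real^'m \<Rightarrow> real" where
  "max_step s = Max (range (\<lambda>j. s $ j))"

definition update_rule ::
  "real^'m \<Rightarrow> real^'m \<Rightarrow> real \<Rightarrow> real \<Rightarrow> (nat \<Rightarrow> real^'m) \<Rightarrow> (nat \<Rightarrow> real) \<Rightarrow> bool" where
  "update_rule u \<nu> a b \<gamma> lam \<longleftrightarrow>
     0 < b \<and> b < a \<and> a < 1 \<and> a + b < 1 \<and>
     (\<forall>k i. 0 \<le> \<gamma> k $ i) \<and> 0 < max_step (\<gamma> 0) \<and> 0 < lam 0 \<and>
     (\<forall>k. max_step (\<gamma> k) = max_step (\<gamma> 0) / (real k + 1) powr a) \<and>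
     (\<forall>k. lam k = lam 0 / (real k + 1) powr b) \<and>
     (\<exists>\<theta>>0. \<forall>k. 1 / real CARD('m) * (u \<bullet> (diag_mat (\<gamma> k) *v \<nu>)) \<ge> \<theta> * max_step (\<gamma> k))"

definition weighted_avg :: "real^'m \<Rightarrow> real^'n^'m \<Rightarrow> real^'n" where
  "weighted_avg w X = (1 / real CARD('m)) *\<^sub>R (w v* X)"

definition vector_norm :: "('a::real_vector \<Rightarrow> real) \<Rightarrow> bool" where
  "vector_norm N \<longleftrightarrow> (\<forall>v. 0 \<le> N v) \<and> (\<forall>v. N v = 0 \<longleftrightarrow> v = 0) \<and>
     (\<forall>c v. N (c *\<^sub>R v) = \<bar>c\<bar> * N v) \<and> (\<forall>v w. N (v + w) \<le> N v + N w)"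

text \<open>Extension of a vector norm to \<open>m \<times> n\<close> matrices: the 2-norm of the norms of the columns.\<close>

definition ext_norm :: "(real^'m \<Rightarrow> real) \<Rightarrow> real^'n^'m \<Rightarrow> real" where
  "ext_norm N W = norm ((\<chi> j. N (column j W)) :: real^'n)"

definition induced_norm :: "(real^'m \<Rightarrow> real) \<Rightarrow> real^'m^'m \<Rightarrow> real" where
  "induced_norm N M = (SUP v. N (M *v v) / N v)"

end

theory Submission
  imports Defs "HOL-Real_Asymp.Real_Asymp"
begin

text \<open>
  Let \<open>p\<^sub>k\<close> be the minimiser of \<open>g + \<lambda>\<^sub>k f\<close>. The consensus error of \<open>x\<close>, the tracking error of \<open>y\<close> and
  the distance \<open>t\<^sub>k\<close> of \<open>xbar\<^sub>k\<close> to \<open>p\<^sub>k\<close> satisfy a coupled linear recursion: the first two contract at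
  constant rate, \<open>t\<^sub>k\<close> contracts by \<open>1 - \<kappa> \<gamma>\<^sub>k \<lambda>\<^sub>k\<close>, and the only noise is the drift \<open>O(1/k)\<close> of \<open>p\<^sub>k\<close>
  and \<open>\<lambda>\<^sub>k\<close>. Hence all three are \<open>O(k powr -(1 - a - b))\<close>. Comparing the values of \<open>g + \<lambda>\<^sub>k f\<close> at
  \<open>xbar\<^sub>k\<close>, \<open>p\<^sub>k\<close> and \<open>x\<^sup>*\<close> gives \<open>\<lambda>\<^sub>k (f(xbar\<^sub>k) - f(x\<^sup>*)) + g(xbar\<^sub>k) = O(t\<^sub>k\<^sup>2)\<close>, which yields both
  value estimates; convergence follows by compactness, as \<open>x\<^sup>*\<close> is the only zero of
  \<open>g + max 0 (f - f(x\<^sup>*))\<close>.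
\<close>

section \<open>Scalar recursions\<close>

text \<open>The strong monotonicity available for \<open>g + lam f\<close> is
  \<open>lam k * \<mu>\<close>, which vanishes, so there is no fixed linear rate and the target
  moves. Errors are measured from \<open>p k\<close> rather than from \<open>xs\<close> because the
  averaged regularised gradient vanishes at \<open>p k\<close>: the size of \<open>y\<close> is then
  bounded by the errors themselves, and no constant gradient bound enters. The drift of
  \<open>p k\<close> is a change of \<open>lam\<close> divided by the modulus; the relative change
  of \<open>lam\<close> is at most \<open>1 / (k + 1)\<close>, so \<open>lam\<close> cancels. Noise
  of order \<open>1 / k\<close> over a contraction of order \<open>k powr -(a + b)\<close> gives the
  exponent \<open>1 - a - b\<close>. Values gain by squaring: for the exponents of the theorem, the
  square of \<open>t\<close> over \<open>lam\<close> has exponent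
  \<open>2 * (1 - a - b) - b = 1 + \<epsilon>\<close>, better than the claimed
  \<open>1 - \<epsilon>\<close>. The infeasibility estimate is weaker because an infeasible average
  may have a value below the optimum, and this possible deficit enters with the factor
  \<open>lam\<close>.\<close>

lemma recursion_bound:
  fixes V \<rho> q :: "nat \<Rightarrow> real" and c :: real
  assumes rec: "\<forall>\<^sub>F k in sequentially. V (Suc k) \<le> (1 - \<rho> k) * V k + c * \<rho> k * q k"
    and \<rho>1: "\<forall>\<^sub>F k in sequentially. \<rho> k \<le> 1"
    and \<rho>2: "\<forall>\<^sub>F k in sequentially. 2 / (real k + 1) \<le> \<rho> k"
    and q: "\<And>k. q k > 0" "\<And>k. (1 - 1 / (real k + 1)) * q k \<le> q (Suc k)"
  shows "\<exists>B\<ge>0. \<forall>\<^sub>F k in sequentially. V k \<le> B * q k"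
proof -
  obtain K where K: "\<And>k. k \<ge> K \<Longrightarrow> V (Suc k) \<le> (1 - \<rho> k) * V k + c * \<rho> k * q k \<and>
      \<rho> k \<le> 1 \<and> 2 / (real k + 1) \<le> \<rho> k"
    using eventually_conj[OF rec eventually_conj[OF \<rho>1 \<rho>2]]
    by (auto simp: eventually_sequentially)
  \<comment> \<open>With \<open>2 * \<bar>c\<bar>\<close>, half of the contraction pays for the
    noise; the other half, at least \<open>1 / (k + 1)\<close>, pays for the decay of
    \<open>q\<close>. The second entry starts the induction at \<open>K\<close>.\<close>
  define B where "B = max (2 * \<bar>c\<bar>) (\<bar>V K\<bar> / q K)"
  have B0: "B \<ge> 0" "B \<ge> 2 * \<bar>c\<bar>" "B * q K \<ge> V K"
    using q(1)[of K] by (auto simp: B_def field_simps max_def)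
  have "V k \<le> B * q k" if "k \<ge> K" for k
    using that
  proof (induction k rule: dec_induct)
    case base
    then show ?case using B0 by simp
  next
    case (step k)
    have \<rho>: "V (Suc k) \<le> (1 - \<rho> k) * V k + c * \<rho> k * q k" "\<rho> k \<le> 1" "2 / (real k + 1) \<le> \<rho> k"
      using K[OF step.hyps(1)] by auto
    have \<rho>0: "\<rho> k \<ge> 0"
      using \<rho>(3) by (rule order_trans[rotated]) simp
    have "c * \<rho> k \<le> B / 2 * \<rho> k"
      using B0 \<rho>0 by (intro mult_right_mono) auto
    moreover have "B / (real k + 1) \<le> B / 2 * \<rho> k"
      using mult_left_mono[OF \<rho>(3), of "B / 2"] B0 by simp
    ultimately have "c * \<rho> k + B / (real k + 1) \<le> B * \<rho> k"
      by linarith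
    then have "(1 - \<rho> k) * B + c * \<rho> k \<le> B * (1 - 1 / (real k + 1))"
      by (simp add: algebra_simps)
    then have le: "((1 - \<rho> k) * B + c * \<rho> k) * q k \<le> B * (1 - 1 / (real k + 1)) * q k"
      using q(1)[of k] by (intro mult_right_mono) auto
    have "V (Suc k) \<le> (1 - \<rho> k) * (B * q k) + c * \<rho> k * q k"
      using \<rho>(1) mult_left_mono[OF step.IH, of "1 - \<rho> k"] \<rho>(2) by linarith
    also have "\<dots> = ((1 - \<rho> k) * B + c * \<rho> k) * q k"
      by (simp add: algebra_simps)
    also have "\<dots> \<le> B * ((1 - 1 / (real k + 1)) * q k)"
      using le by (simp add: mult.assoc)
    also have "\<dots> \<le> B * q (Suc k)"
      using B0 q(2) by (intro mult_left_mono) auto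
    finally show ?case .
  qed
  then show ?thesis
    using B0(1) eventually_sequentially by blast
qed

text \<open>Supplies the slow-decay hypothesis of \<open>recursion_bound\<close>: for a base in
  [0, 1], lowering the exponent from 1 to \<open>r\<close> can only raise the power.\<close>

lemma powr_ratio_bound:
  fixes r :: real
  assumes "0 \<le> r" "r \<le> 1"
  shows "(1 - 1 / (real k + 1)) * (real k + 1) powr - r \<le> (real (Suc k) + 1) powr - r"
proof -
  have "1 - 1 / (real k + 1) \<le> (real k + 1) / (real k + 2)"
    by (simp add: field_simps)
  also have "\<dots> = ((real k + 1) / (real k + 2)) powr 1"
    by simp
  also have "\<dots> \<le> ((real k + 1) / (real k + 2)) powr r"
    using assms by (intro powr_mono') auto
  also have "\<dots> = (real (Suc k) + 1) powr - r / (real k + 1) powr - r"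
    by (simp add: powr_divide powr_minus_divide add.commute)
  finally show ?thesis
    by (simp add: field_simps)
qed

text \<open>This is \<open>recursion_bound\<close> with constant
  \<open>\<rho> = 1 - \<sigma>\<close>, the noise constant being rescaled by
  \<open>1 / (1 - \<sigma>)\<close>.\<close>

lemma contraction_rate:
  fixes e :: "nat \<Rightarrow> real" and \<sigma> c r :: real
  assumes "0 \<le> \<sigma>" "\<sigma> < 1" and r: "0 < r" "r \<le> 1"
    and rec: "\<forall>\<^sub>F k in sequentially. e (Suc k) \<le> \<sigma> * e k + c * (real k + 1) powr - r"
  shows "\<exists>B\<ge>0. \<forall>\<^sub>F k in sequentially. e k \<le> B * (real k + 1) powr - r"
proof (rule recursion_bound)
  show "\<forall>\<^sub>F k in sequentially. e (Suc k)
      \<le> (1 - (1 - \<sigma>)) * e k + c / (1 - \<sigma>) * (1 - \<sigma>) * (real k + 1) powr - r"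
    using rec assms(2) by simp
  have "(\<lambda>k. 2 / (real k + 1)) \<longlonglongrightarrow> 0"
    by real_asymp
  then have "\<forall>\<^sub>F k in sequentially. 2 / (real k + 1) < 1 - \<sigma>"
    by (rule order_tendstoD(2)) (use assms(2) in simp)
  then show "\<forall>\<^sub>F k in sequentially. 2 / (real k + 1) \<le> 1 - \<sigma>"
    by (rule eventually_mono) simp
qed (use assms powr_ratio_bound in auto)

text \<open>
  The Lyapunov function is \<open>t + \<delta> * lam * (P * ex + ey)\<close>. The factor \<open>lam\<close> lets the contraction
  \<open>\<kappa> * gam * lam\<close> of \<open>t\<close> absorb the feedback of \<open>t\<close> into \<open>ex\<close> and \<open>ey\<close>, and the feedback of
  these into \<open>t\<close> costs only the factor \<open>gam / lam\<close>, which vanishes because \<open>b < a\<close>. A large \<open>P\<close>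
  absorbs the term \<open>c * ex\<close> in the recursion of \<open>ey\<close>.
\<close>

lemma coupled_rates:
  fixes ex ey t gam lam :: "nat \<Rightarrow> real" and a b \<sigma> \<gamma>0 l0 \<kappa> c :: real
  assumes ab: "0 < b" "b < a" "a + b < 1"
    and \<sigma>: "0 \<le> \<sigma>" "\<sigma> < 1" and pos: "0 < \<gamma>0" "0 < l0" "0 < \<kappa>" "0 \<le> c"
    and gam: "\<And>k. gam k = \<gamma>0 / (real k + 1) powr a"
    and lam: "\<And>k. lam k = l0 / (real k + 1) powr b"
    and nonneg: "\<And>k. 0 \<le> ex k" "\<And>k. 0 \<le> ey k" "\<And>k. 0 \<le> t k"
    and ex: "\<And>k. ex (Suc k) \<le> \<sigma> * ex k + c * gam k * (ex k + ey k + t k)"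
    and ey: "\<And>k. ey (Suc k) \<le> \<sigma> * ey k + c * ex k + c * gam k * (ex k + ey k + t k) + c / (real k + 1)"
    and t: "\<forall>\<^sub>F k in sequentially. t (Suc k) \<le>
        (1 - \<kappa> * gam k * lam k) * t k + c * gam k * (ex k + ey k) + c / (real k + 1)"
  defines "q \<equiv> \<lambda>k::nat. (real k + 1) powr - (1 - a - b)"
  shows "\<exists>B\<ge>0. \<forall>\<^sub>F k in sequentially. ex k \<le> B * q k \<and> ey k \<le> B * q k \<and> t k \<le> B * q k"
proof -
  have gam0: "gam k > 0" and lam0: "lam k > 0" and q0: "q k > 0" for k
    using pos by (auto simp: gam lam q_def)
  have r: "0 < 1 - a - b" "1 - a - b \<le> 1"
    using ab by auto
  have lam_dec: "lam (Suc k) \<le> lam k" for k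
    using pos ab by (auto simp: lam intro!: divide_left_mono powr_mono2)
  have lam_le: "lam k \<le> l0" for k
    using pos ab by (auto simp: lam field_simps intro!: ge_one_powr_ge_zero)
  \<comment> \<open>Of the slack \<open>P * (1 - \<sigma>) = c + 1\<close> in the contraction of
    \<open>P * ex\<close>, the part \<open>c\<close> absorbs \<open>c * ex\<close> from the
    recursion of \<open>ey\<close>, and 1 is left for the vanishing terms.\<close>
  define P where "P = (c + 1) / (1 - \<sigma>)"
  have P: "P * (1 - \<sigma>) = c + 1" "P > 0"
    using \<sigma> pos by (auto simp: P_def)
  \<comment> \<open>Makes the feedback of \<open>t\<close> into \<open>P * ex + ey\<close>, which is
    \<open>(P + 1) * c * gam\<close> before weighting by \<open>\<delta> * lam\<close>, cost at most
    half of the contraction of \<open>t\<close>. The other half is \<open>\<rho>\<close>.\<close>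
  define \<delta> where "\<delta> = \<kappa> / (2 * (P + 1) * (c + 1))"
  have \<delta>0: "\<delta> > 0"
    using P pos by (auto simp: \<delta>_def)
  have "2 * (P + 1) * (c + 1) \<noteq> 0"
    using P pos by simp
  then have "\<delta> * (2 * (P + 1) * (c + 1)) = \<kappa>"
    unfolding \<delta>_def by (metis nonzero_eq_divide_eq)
  then have "\<delta> * (P + 1) * (c + 1) = \<kappa> / 2"
    by (simp add: algebra_simps)
  moreover have "\<delta> * (P + 1) * c \<le> \<delta> * (P + 1) * (c + 1)"
    using \<delta>0 P by (intro mult_left_mono) auto
  ultimately have \<delta>: "\<delta> * (P + 1) * c \<le> \<kappa> / 2"
    by simp
  define V where "V k = t k + \<delta> * lam k * (P * ex k + ey k)" for k
  define \<rho> where "\<rho> k = \<kappa> / 2 * gam k * lam k" for k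
  define c' where "c' = c * (1 + \<delta> * l0) / (\<kappa> / 2 * \<gamma>0 * l0)"
  have \<rho>_eq: "\<rho> k = \<kappa> / 2 * \<gamma>0 * l0 * (real k + 1) powr - (a + b)" for k
    unfolding \<rho>_def gam lam powr_minus powr_add by (simp add: divide_simps)
  \<comment> \<open>The exponents \<open>a + b\<close> and \<open>1 - a - b\<close> add up to 1, so
    noise of order \<open>1 / (k + 1)\<close> is exactly of the form \<open>\<rho> * q\<close>. This
    fixes the rate \<open>q\<close>.\<close>
  have noise: "c' * \<rho> k * q k = c * (1 + \<delta> * l0) / (real k + 1)" for k
  proof -
    have "(real k + 1) powr - (a + b) * (real k + 1) powr - (1 - a - b) = (real k + 1) powr -1"
      by (simp flip: powr_add)
    also have "\<dots> = 1 / (real k + 1)"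
      by (simp add: powr_minus_divide)
    finally show ?thesis
      unfolding c'_def \<rho>_eq q_def using pos by (simp add: field_simps)
  qed
  have gl: "gam k / lam k = \<gamma>0 / l0 * (real k + 1) powr - (a - b)" for k
    using pos by (simp add: gam lam powr_diff powr_minus field_simps)
  have gam_lim: "gam \<longlonglongrightarrow> 0"
    unfolding gam using ab by real_asymp
  have gl_lim: "(\<lambda>k. gam k / lam k) \<longlonglongrightarrow> 0"
    unfolding gl using ab by real_asymp
  have \<rho>_lim: "\<rho> \<longlonglongrightarrow> 0"
    unfolding \<rho>_eq using ab by real_asymp
  \<comment> \<open>All that has to fit into the gap \<open>1 - \<sigma>\<close>: the feedback of
    \<open>ex\<close> and \<open>ey\<close> on themselves, their effect on \<open>t\<close> divided
    by the weight \<open>\<delta> * lam\<close>, and the target rate \<open>\<rho>\<close>.\<close>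
  define s where "s k = (P + 1) * c * gam k + c / \<delta> * (gam k / lam k) + (P + 1) * \<rho> k" for k
  have "s \<longlonglongrightarrow> (P + 1) * c * 0 + c / \<delta> * 0 + (P + 1) * 0"
    unfolding s_def by (intro tendsto_intros gam_lim gl_lim \<rho>_lim)
  then have s_ev: "\<forall>\<^sub>F k in sequentially. s k < 1 - \<sigma>"
    by (rule order_tendstoD(2)) (use \<sigma> in simp)
  have "\<exists>B\<ge>0. \<forall>\<^sub>F k in sequentially. V k \<le> B * q k"
  proof (rule recursion_bound)
    show "\<forall>\<^sub>F k in sequentially. V (Suc k) \<le> (1 - \<rho> k) * V k + c' * \<rho> k * q k"
      using s_ev t
    proof eventually_elim
      case (elim k)
      have Prho: "0 \<le> P * \<rho> k" "0 \<le> \<rho> k"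
        using P pos gam0[of k] lam0[of k] by (auto simp: \<rho>_def)
      have cex: "\<delta> * lam k * (P * \<sigma> + c + (P + 1) * c * gam k) + c * gam k \<le> \<delta> * lam k * (P * (1 - \<rho> k))"
      proof -
        have "P * \<sigma> + c + (P + 1) * c * gam k + c / \<delta> * (gam k / lam k) \<le> P * (1 - \<rho> k)"
          using elim(1) P(1) Prho \<sigma> by (simp add: s_def algebra_simps)
        then have "\<delta> * lam k * (P * \<sigma> + c + (P + 1) * c * gam k + c / \<delta> * (gam k / lam k))
            \<le> \<delta> * lam k * (P * (1 - \<rho> k))"
          using \<delta>0 lam0[of k] by (intro mult_left_mono) auto
        then show ?thesis
          using \<delta>0 lam0[of k] by (simp add: distrib_left)
      qed
      have cey: "\<delta> * lam k * (\<sigma> + (P + 1) * c * gam k) + c * gam k \<le> \<delta> * lam k * (1 - \<rho> k)"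
      proof -
        have "\<sigma> + (P + 1) * c * gam k + c / \<delta> * (gam k / lam k) \<le> 1 - \<rho> k"
          using elim(1) Prho by (simp add: s_def algebra_simps)
        then have "\<delta> * lam k * (\<sigma> + (P + 1) * c * gam k + c / \<delta> * (gam k / lam k))
            \<le> \<delta> * lam k * (1 - \<rho> k)"
          using \<delta>0 lam0[of k] by (intro mult_left_mono) auto
        then show ?thesis
          using \<delta>0 lam0[of k] by (simp add: distrib_left)
      qed
      have ct: "1 - \<kappa> * gam k * lam k + \<delta> * lam k * ((P + 1) * c * gam k) \<le> 1 - \<rho> k"
        using mult_right_mono[OF \<delta>, of "gam k * lam k"] gam0[of k] lam0[of k]
        by (simp add: \<rho>_def algebra_simps)
      have cn: "c / (real k + 1) + \<delta> * lam k * (c / (real k + 1)) \<le> c' * \<rho> k * q k"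
      proof -
        have "\<delta> * lam k * (c / (real k + 1)) \<le> \<delta> * l0 * (c / (real k + 1))"
          using \<delta>0 pos lam_le[of k] by (intro mult_right_mono mult_left_mono) auto
        then show ?thesis
          unfolding noise by (simp add: add_divide_distrib distrib_left mult.commute mult.left_commute)
      qed
      let ?S = "c * gam k * (ex k + ey k + t k)"
      have "V (Suc k) \<le> t (Suc k) + \<delta> * lam k * (P * ex (Suc k) + ey (Suc k))"
        unfolding V_def using lam_dec[of k] \<delta>0 P nonneg
        by (intro add_left_mono mult_right_mono mult_left_mono) auto
      also have "\<dots> \<le> ((1 - \<kappa> * gam k * lam k) * t k + c * gam k * (ex k + ey k) + c / (real k + 1)) +
          \<delta> * lam k * (P * (\<sigma> * ex k + ?S) + (\<sigma> * ey k + c * ex k + ?S + c / (real k + 1)))"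
        using elim(2) ex[of k] ey[of k] \<delta>0 P lam0[of k]
        by (intro add_mono mult_left_mono) auto
      also have "\<dots> = (\<delta> * lam k * (P * \<sigma> + c + (P + 1) * c * gam k) + c * gam k) * ex k
          + (\<delta> * lam k * (\<sigma> + (P + 1) * c * gam k) + c * gam k) * ey k
          + (1 - \<kappa> * gam k * lam k + \<delta> * lam k * ((P + 1) * c * gam k)) * t k
          + (c / (real k + 1) + \<delta> * lam k * (c / (real k + 1)))"
        by (simp add: algebra_simps)
      also have "\<dots> \<le> (\<delta> * lam k * (P * (1 - \<rho> k))) * ex k + (\<delta> * lam k * (1 - \<rho> k)) * ey k
          + (1 - \<rho> k) * t k + c' * \<rho> k * q k"
        using cex cey ct cn nonneg by (intro add_mono mult_right_mono) auto
      also have "\<dots> = (1 - \<rho> k) * V k + c' * \<rho> k * q k"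
        by (simp add: V_def algebra_simps)
      finally show ?case .
    qed
    show "\<forall>\<^sub>F k in sequentially. \<rho> k \<le> 1"
      using order_tendstoD(2)[OF \<rho>_lim, of 1] by (auto elim: eventually_mono)
    have "0 < \<kappa> / 2 * \<gamma>0 * l0"
      using pos by simp
    \<comment> \<open>Since \<open>a + b < 1\<close>, the contraction decays more slowly than
      \<open>1 / k\<close>.\<close>
    then have "\<forall>\<^sub>F k in sequentially. 2 / (real k + 1) \<le> (\<kappa> / 2 * \<gamma>0 * l0) * (real k + 1) powr - (a + b)"
      using ab by real_asymp
    then show "\<forall>\<^sub>F k in sequentially. 2 / (real k + 1) \<le> \<rho> k"
      unfolding \<rho>_eq .
  qed (use q0 powr_ratio_bound[of "1 - a - b"] r in \<open>auto simp: q_def\<close>)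
  then obtain B where B: "B \<ge> 0" "\<forall>\<^sub>F k in sequentially. V k \<le> B * q k"
    by blast
  \<comment> \<open>Because of the weight \<open>lam\<close>, \<open>V\<close> bounds
    \<open>ex\<close> and \<open>ey\<close> only by \<open>q / lam\<close>. Feedback in their own
    recursions carries the factor \<open>gam\<close>, and \<open>gam / lam\<close> is bounded, so a
    second pass recovers the rate \<open>q\<close>: first for \<open>ex\<close>, then for
    \<open>ey\<close>, whose recursion contains \<open>c * ex\<close> without this factor.\<close>
  define B1 where "B1 = B / \<delta> * (1 / P + 1) * (\<gamma>0 / l0) + B * \<gamma>0"
  have cross: "\<forall>\<^sub>F k in sequentially. t k \<le> B * q k \<and> gam k * (ex k + ey k + t k) \<le> B1 * q k"
    using B(2)
  proof eventually_elim
    case (elim k)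
    have "0 \<le> \<delta> * lam k * (P * ex k + ey k)"
      using \<delta>0 lam0[of k] P nonneg by simp
    then have t: "t k \<le> B * q k" and e: "\<delta> * lam k * (P * ex k + ey k) \<le> B * q k"
      using elim nonneg(3)[of k] by (auto simp: V_def)
    have e': "P * ex k + ey k \<le> B / \<delta> * (q k / lam k)"
      using e \<delta>0 lam0[of k] by (simp add: field_simps)
    have "ex k \<le> 1 / P * (P * ex k + ey k)" "ey k \<le> P * ex k + ey k"
      using P nonneg by (auto simp: field_simps)
    then have "ex k + ey k \<le> (1 / P + 1) * (P * ex k + ey k)"
      by (simp add: algebra_simps)
    also have "\<dots> \<le> (1 / P + 1) * (B / \<delta> * (q k / lam k))"
      using P e' by (intro mult_left_mono) auto
    finally have "gam k * (ex k + ey k) \<le> gam k * ((1 / P + 1) * (B / \<delta> * (q k / lam k)))"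
      using gam0[of k] by (intro mult_left_mono) auto
    also have "\<dots> = B / \<delta> * (1 / P + 1) * q k * (gam k / lam k)"
      by (simp add: mult_ac)
    also have "\<dots> \<le> B / \<delta> * (1 / P + 1) * q k * (\<gamma>0 / l0)"
    proof (intro mult_left_mono)
      have "(real k + 1) powr - (a - b) \<le> 1"
        using ab powr_mono[of "- (a - b)" 0 "real k + 1"] by simp
      then have "\<gamma>0 / l0 * (real k + 1) powr - (a - b) \<le> \<gamma>0 / l0 * 1"
        using pos by (intro mult_left_mono) auto
      then show "gam k / lam k \<le> \<gamma>0 / l0"
        unfolding gl by simp
    qed (use B(1) \<delta>0 P q0[of k] in auto)
    finally have 1: "gam k * (ex k + ey k) \<le> B / \<delta> * (1 / P + 1) * q k * (\<gamma>0 / l0)" .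
    have "gam k \<le> \<gamma>0"
      using pos ab by (auto simp: gam field_simps intro!: ge_one_powr_ge_zero)
    then have "gam k * t k \<le> \<gamma>0 * (B * q k)"
      using t pos nonneg(3) by (intro mult_mono) auto
    with 1 have "gam k * (ex k + ey k + t k) \<le> B1 * q k"
      by (simp add: B1_def algebra_simps)
    with t show ?case by simp
  qed
  have "\<exists>B\<ge>0. \<forall>\<^sub>F k in sequentially. ex k \<le> B * (real k + 1) powr - (1 - a - b)"
  proof (rule contraction_rate)
    show "\<forall>\<^sub>F k in sequentially. ex (Suc k) \<le> \<sigma> * ex k + c * B1 * (real k + 1) powr - (1 - a - b)"
      using cross
    proof eventually_elim
      case (elim k)
      then show ?case
        using ex[of k] mult_left_mono[of "gam k * (ex k + ey k + t k)" "B1 * q k" c] pos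
        by (simp add: q_def mult.assoc)
    qed
  qed (use \<sigma> r in auto)
  then obtain Bx where Bx: "Bx \<ge> 0" "\<forall>\<^sub>F k in sequentially. ex k \<le> Bx * q k"
    by (auto simp: q_def)
  have "\<exists>B\<ge>0. \<forall>\<^sub>F k in sequentially. ey k \<le> B * (real k + 1) powr - (1 - a - b)"
  proof (rule contraction_rate)
    show "\<forall>\<^sub>F k in sequentially. ey (Suc k) \<le> \<sigma> * ey k + (c * Bx + c * B1 + c) * (real k + 1) powr - (1 - a - b)"
      using cross Bx(2)
    proof eventually_elim
      case (elim k)
      have "1 / (real k + 1) = (real k + 1) powr - 1"
        by (simp add: powr_minus_divide)
      also have "\<dots> \<le> q k"
        unfolding q_def using ab by (intro powr_mono) auto
      finally have "c * (1 / (real k + 1)) \<le> c * q k"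
        using pos by (intro mult_left_mono) auto
      moreover have "c * ex k \<le> c * (Bx * q k)"
        using elim pos by (intro mult_left_mono) auto
      moreover have "c * (gam k * (ex k + ey k + t k)) \<le> c * (B1 * q k)"
        using elim pos by (intro mult_left_mono) auto
      ultimately show ?case
        using ey[of k] by (simp add: q_def algebra_simps)
    qed
  qed (use \<sigma> r in auto)
  then obtain By where By: "By \<ge> 0" "\<forall>\<^sub>F k in sequentially. ey k \<le> By * q k"
    by (auto simp: q_def)
  have "\<forall>\<^sub>F k in sequentially. ex k \<le> (Bx + By + B) * q k \<and> ey k \<le> (Bx + By + B) * q k
      \<and> t k \<le> (Bx + By + B) * q k"
    using Bx(2) By(2) cross
  proof eventually_elim
    case (elim k)
    moreover have "0 \<le> Bx * q k" "0 \<le> By * q k" "0 \<le> B * q k"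
      using B(1) Bx(1) By(1) q0[of k] by simp_all
    ultimately show ?case
      by (simp add: distrib_right)
  qed
  then show ?thesis
    using B(1) Bx(1) By(1) by (intro exI[of _ "Bx + By + B"]) auto
qed

section \<open>Gradients and strong monotonicity\<close>

lemma GDERIV_unique:
  assumes "GDERIV h x :> D" "GDERIV h x :> E"
  shows "D = E"
proof -
  have "(\<lambda>v. v \<bullet> D) = (\<lambda>v. v \<bullet> E)"
    using assms unfolding gderiv_def by (rule has_derivative_unique)
  then have "\<forall>v. v \<bullet> D = v \<bullet> E"
    by (simp add: fun_eq_iff)
  then show ?thesis
    by (simp add: vector_eq_ldot)
qed

lemma gradient_eqI:
  assumes "GDERIV h x :> D"
  shows "gradient h x = D"
  unfolding gradient_def using assms by (rule the_equality) (rule GDERIV_unique[OF _ assms])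

text \<open>Riesz representation in coordinates: the representing vector has the values of the
  derivative on the basis as its components.\<close>

lemma GDERIV_gradient:
  fixes h :: "'a::euclidean_space \<Rightarrow> real"
  assumes "h differentiable (at x)"
  shows "GDERIV h x :> gradient h x"
proof -
  obtain h' where h': "(h has_derivative h') (at x)"
    using assms by (auto simp: differentiable_def)
  interpret bounded_linear h'
    using h' by (rule has_derivative_bounded_linear)
  have "h' v = v \<bullet> (\<Sum>i\<in>Basis. h' i *\<^sub>R i)" for v
  proof -
    have "h' v = h' (\<Sum>i\<in>Basis. (v \<bullet> i) *\<^sub>R i)"
      by (simp add: euclidean_representation)
    also have "\<dots> = v \<bullet> (\<Sum>i\<in>Basis. h' i *\<^sub>R i)"
      by (simp add: sum scale inner_sum_right mult.commute)
    finally show ?thesis .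
  qed
  then have "h' = (\<lambda>v. v \<bullet> (\<Sum>i\<in>Basis. h' i *\<^sub>R i))"
    by (rule ext)
  then have "GDERIV h x :> (\<Sum>i\<in>Basis. h' i *\<^sub>R i)"
    using h' unfolding gderiv_def by simp
  then show ?thesis
    using gradient_eqI by metis
qed

lemma GDERIV_sum:
  assumes "\<And>i. i \<in> I \<Longrightarrow> GDERIV (h i) x :> D i"
  shows "GDERIV (\<lambda>x. \<Sum>i\<in>I. h i x) x :> (\<Sum>i\<in>I. D i)"
  using assms by (simp add: gderiv_def inner_sum_right has_derivative_sum)

lemma GDERIV_compose_affine:
  fixes w x :: "'a::real_inner"
  assumes "DERIV \<psi> (w \<bullet> x - \<beta>) :> s"
  shows "GDERIV (\<lambda>x. \<psi> (w \<bullet> x - \<beta>)) x :> s *\<^sub>R w"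
proof -
  have "((\<lambda>x. w \<bullet> x - \<beta>) has_derivative (\<lambda>v. w \<bullet> v)) (at x)"
    by (auto intro!: derivative_eq_intros)
  then have "((\<lambda>x. \<psi> (w \<bullet> x - \<beta>)) has_derivative (\<lambda>v. s * (w \<bullet> v))) (at x)"
    using assms by (auto simp: has_field_derivative_def intro: has_derivative_compose)
  then show ?thesis
    by (simp add: gderiv_def inner_commute)
qed

text \<open>Along the segment, subtract the tangent and the quadratic from \<open>h\<close>.
  Monotonicity between \<open>x + s v\<close> and \<open>x\<close>, divided by \<open>s\<close>,
  says that the rest has nonnegative derivative. With \<open>\<mu> = 0\<close> this is the tangent
  inequality of convex functions.\<close>

lemma strongly_monotone_gradient_lower_bound:
  fixes h :: "'a::real_inner \<Rightarrow> real"
  assumes D: "\<And>x. GDERIV h x :> D x"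
    and mono: "\<And>x y. \<mu> * (norm (x - y))\<^sup>2 \<le> (D x - D y) \<bullet> (x - y)"
  shows "h x + D x \<bullet> (y - x) + \<mu> / 2 * (norm (y - x))\<^sup>2 \<le> h y"
proof -
  define v where "v = y - x"
  define \<phi> where "\<phi> s = h (x + s *\<^sub>R v) - s * (D x \<bullet> v) - \<mu> / 2 * s\<^sup>2 * (norm v)\<^sup>2" for s
  have "\<phi> 0 \<le> \<phi> 1"
  proof (rule DERIV_nonneg_imp_nondecreasing[where f = \<phi>])
    fix s :: real assume s: "0 \<le> s" "s \<le> 1"
    have "((\<lambda>s. x + s *\<^sub>R v) has_derivative (\<lambda>h. h *\<^sub>R v)) (at s)"
      by (auto intro!: derivative_eq_intros)
    moreover have "(h has_derivative (\<lambda>w. w \<bullet> D (x + s *\<^sub>R v))) (at (x + s *\<^sub>R v))"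
      using D by (simp add: gderiv_def)
    ultimately have "((\<lambda>s. h (x + s *\<^sub>R v)) has_derivative (\<lambda>h. (h *\<^sub>R v) \<bullet> D (x + s *\<^sub>R v))) (at s)"
      by (rule has_derivative_compose)
    moreover have "(\<lambda>h. (h *\<^sub>R v) \<bullet> D (x + s *\<^sub>R v)) = (*) (D (x + s *\<^sub>R v) \<bullet> v)"
      by (auto simp: inner_commute mult.commute)
    ultimately have "((\<lambda>s. h (x + s *\<^sub>R v)) has_real_derivative (D (x + s *\<^sub>R v) \<bullet> v)) (at s)"
      by (simp add: has_field_derivative_def)
    then have "(\<phi> has_real_derivative (D (x + s *\<^sub>R v) \<bullet> v - D x \<bullet> v - \<mu> * s * (norm v)\<^sup>2)) (at s)"
      unfolding \<phi>_def by (auto intro!: derivative_eq_intros)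
    moreover have "\<mu> * s * (norm v)\<^sup>2 \<le> (D (x + s *\<^sub>R v) - D x) \<bullet> v"
    proof (cases "s = 0")
      case False
      have "s * (\<mu> * s * (norm v)\<^sup>2) \<le> s * ((D (x + s *\<^sub>R v) - D x) \<bullet> v)"
        using mono[of "x + s *\<^sub>R v" x] s by (simp add: power_mult_distrib power2_eq_square mult_ac)
      then show ?thesis
        using s False by simp
    qed simp
    ultimately show "\<exists>d. (\<phi> has_real_derivative d) (at s) \<and> 0 \<le> d"
      by (intro exI[of _ "D (x + s *\<^sub>R v) \<bullet> v - D x \<bullet> v - \<mu> * s * (norm v)\<^sup>2"])
        (simp add: inner_diff_left)
  qed simp
  then show ?thesis
    by (simp add: \<phi>_def v_def)
qed

text \<open>After expanding the square, \<open>\<alpha> * L\<^sup>2 \<le> \<mu>\<close> lets the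
  quadratic term consume at most half of the gain \<open>2 * \<alpha> * \<mu>\<close>;
  \<open>\<alpha> * \<mu> \<le> 1\<close> keeps the factor nonnegative. The lemma serves both the
  existence of \<open>p k\<close> and the step of the average.\<close>

lemma gradient_step_contraction:
  fixes D :: "'a::real_inner \<Rightarrow> 'a"
  assumes mono: "\<And>x y. \<mu> * (norm (x - y))\<^sup>2 \<le> (D x - D y) \<bullet> (x - y)"
    and lip: "\<And>x y. norm (D x - D y) \<le> L * norm (x - y)"
    and \<alpha>: "0 \<le> \<alpha>" "\<alpha> * L\<^sup>2 \<le> \<mu>" "\<alpha> * \<mu> \<le> 1"
  shows "norm ((x - \<alpha> *\<^sub>R D x) - (y - \<alpha> *\<^sub>R D y)) \<le> (1 - \<alpha> * \<mu> / 2) * norm (x - y)"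
proof (rule power2_le_imp_le)
  define v w where "v = x - y" and "w = D x - D y"
  have "(norm ((x - \<alpha> *\<^sub>R D x) - (y - \<alpha> *\<^sub>R D y)))\<^sup>2 = (norm (v - \<alpha> *\<^sub>R w))\<^sup>2"
    by (simp add: v_def w_def algebra_simps)
  also have "\<dots> = (norm v)\<^sup>2 - 2 * \<alpha> * (w \<bullet> v) + \<alpha>\<^sup>2 * (norm w)\<^sup>2"
    unfolding power2_norm_eq_inner
    by (simp add: inner_diff_left inner_diff_right inner_commute power2_eq_square algebra_simps)
  also have "\<dots> \<le> (norm v)\<^sup>2 - 2 * \<alpha> * (\<mu> * (norm v)\<^sup>2) + \<alpha> * \<mu> * (norm v)\<^sup>2"
  proof -
    have "\<alpha> * (\<mu> * (norm v)\<^sup>2) \<le> \<alpha> * (w \<bullet> v)"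
      using mono[of x y] \<alpha> by (intro mult_left_mono) (auto simp: v_def w_def)
    moreover have "\<alpha>\<^sup>2 * (norm w)\<^sup>2 \<le> \<alpha> * \<mu> * (norm v)\<^sup>2"
    proof -
      have "(norm w)\<^sup>2 \<le> (L * norm v)\<^sup>2"
        using lip[of x y] by (intro power_mono) (auto simp: v_def w_def)
      then have "\<alpha>\<^sup>2 * (norm w)\<^sup>2 \<le> \<alpha> * (\<alpha> * L\<^sup>2) * (norm v)\<^sup>2"
        by (metis (no_types, lifting) mult.assoc mult_left_mono power2_eq_square power_mult_distrib zero_le_power2)
      also have "\<dots> \<le> \<alpha> * \<mu> * (norm v)\<^sup>2"
        using \<alpha> by (intro mult_right_mono mult_left_mono) auto
      finally show ?thesis .
    qed
    ultimately show ?thesis by simp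
  qed
  also have "\<dots> = (1 - \<alpha> * \<mu>) * (norm v)\<^sup>2"
    by (simp add: algebra_simps)
  also have "\<dots> \<le> (1 - \<alpha> * \<mu> / 2)\<^sup>2 * (norm v)\<^sup>2"
  proof (rule mult_right_mono)
    have "(1 - \<alpha> * \<mu> / 2)\<^sup>2 = 1 - \<alpha> * \<mu> + (\<alpha> * \<mu> / 2)\<^sup>2"
      by (simp add: power2_eq_square algebra_simps)
    then show "1 - \<alpha> * \<mu> \<le> (1 - \<alpha> * \<mu> / 2)\<^sup>2"
      by simp
  qed simp
  finally show "(norm ((x - \<alpha> *\<^sub>R D x) - (y - \<alpha> *\<^sub>R D y)))\<^sup>2 \<le> ((1 - \<alpha> * \<mu> / 2) * norm (x - y))\<^sup>2"
    by (simp add: v_def power_mult_distrib)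
  show "0 \<le> (1 - \<alpha> * \<mu> / 2) * norm (x - y)"
    using \<alpha> by (intro mult_nonneg_nonneg) auto
qed

text \<open>A short step along \<open>- D\<close> is a contraction, and its Banach fixed point is a
  zero of \<open>D\<close>.\<close>

lemma strongly_monotone_has_zero:
  fixes D :: "'a::{real_inner, complete_space} \<Rightarrow> 'a"
  assumes mono: "\<And>x y. \<mu> * (norm (x - y))\<^sup>2 \<le> (D x - D y) \<bullet> (x - y)"
    and lip: "\<And>x y. norm (D x - D y) \<le> L * norm (x - y)"
    and "0 < \<mu>"
  obtains p where "D p = 0"
proof -
  \<comment> \<open>\<open>M \<ge> 1\<close> makes the division by its square safe, and
    \<open>\<mu> \<le> M\<close> gives \<open>\<alpha> * \<mu> \<le> 1\<close>.\<close>
  define M where "M = max 1 (max \<bar>L\<bar> \<mu>)"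
  define \<alpha> where "\<alpha> = \<mu> / M\<^sup>2"
  have M: "M \<ge> 1" "L \<le> M" "\<mu> \<le> M"
    by (auto simp: M_def)
  have M2: "\<mu> * \<mu> \<le> M\<^sup>2"
    using M \<open>0 < \<mu>\<close> unfolding power2_eq_square by (intro mult_mono) auto
  have \<alpha>: "0 < \<alpha>" "\<alpha> * M\<^sup>2 \<le> \<mu>" "\<alpha> * \<mu> \<le> 1"
    using M M2 \<open>0 < \<mu>\<close> by (auto simp: \<alpha>_def field_simps)
  have "norm (D x - D y) \<le> M * norm (x - y)" for x y
    using lip[of x y] M by (meson mult_right_mono norm_ge_zero order_trans)
  then have "dist (x - \<alpha> *\<^sub>R D x) (y - \<alpha> *\<^sub>R D y) \<le> (1 - \<alpha> * \<mu> / 2) * dist x y" for x y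
    unfolding dist_norm using \<alpha> by (intro gradient_step_contraction[OF mono]) auto
  then have "\<exists>!p. p - \<alpha> *\<^sub>R D p = p"
    using \<alpha> \<open>0 < \<mu>\<close> by (intro banach_fix_type[where c = "1 - \<alpha> * \<mu> / 2"]) auto
  then show ?thesis
    using that \<alpha> by auto
qed

text \<open>Covers both parts of the penalty, squared residuals and squared negative parts: each
  term is a function of one affine form with nondecreasing Lipschitz derivative. Monotonicity holds
  term by term, as the change of slope and \<open>w k \<bullet> (y - z)\<close> never have opposite
  signs.\<close>

lemma ridge_sum_gradient:
  fixes w :: "'k \<Rightarrow> 'a::real_inner" and \<psi> s :: "'k \<Rightarrow> real \<Rightarrow> real" and c \<beta> :: "'k \<Rightarrow> real"
  assumes deriv: "\<And>k r. k \<in> K \<Longrightarrow> (\<psi> k has_real_derivative s k r) (at r)"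
    and mono: "\<And>k q r. k \<in> K \<Longrightarrow> q \<le> r \<Longrightarrow> s k q \<le> s k r"
    and lip: "\<And>k q r. k \<in> K \<Longrightarrow> \<bar>s k q - s k r\<bar> \<le> c k * \<bar>q - r\<bar>"
  defines "D \<equiv> \<lambda>z. \<Sum>k\<in>K. s k (w k \<bullet> z - \<beta> k) *\<^sub>R w k"
  shows "GDERIV (\<lambda>z. \<Sum>k\<in>K. \<psi> k (w k \<bullet> z - \<beta> k)) z :> D z"
    and "0 \<le> (D y - D z) \<bullet> (y - z)"
    and "norm (D y - D z) \<le> (\<Sum>k\<in>K. c k * (norm (w k))\<^sup>2) * norm (y - z)"
proof -
  show "GDERIV (\<lambda>z. \<Sum>k\<in>K. \<psi> k (w k \<bullet> z - \<beta> k)) z :> D z"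
    unfolding D_def using deriv by (intro GDERIV_sum GDERIV_compose_affine)
  define \<Delta> where "\<Delta> k = s k (w k \<bullet> y - \<beta> k) - s k (w k \<bullet> z - \<beta> k)" for k
  have D: "D y - D z = (\<Sum>k\<in>K. \<Delta> k *\<^sub>R w k)"
    by (simp add: D_def \<Delta>_def sum_subtractf scaleR_diff_left)
  have "0 \<le> \<Delta> k * (w k \<bullet> (y - z))" if "k \<in> K" for k
  proof (cases "w k \<bullet> z \<le> w k \<bullet> y")
    case True
    then show ?thesis
      using mono[OF that, of "w k \<bullet> z - \<beta> k" "w k \<bullet> y - \<beta> k"]
      by (simp add: \<Delta>_def inner_diff_right)
  next
    case False
    then show ?thesis
      using mono[OF that, of "w k \<bullet> y - \<beta> k" "w k \<bullet> z - \<beta> k"]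
      by (simp add: \<Delta>_def inner_diff_right mult_nonpos_nonpos)
  qed
  then show "0 \<le> (D y - D z) \<bullet> (y - z)"
    unfolding D by (simp add: inner_sum_left sum_nonneg)
  have "norm (\<Delta> k *\<^sub>R w k) \<le> c k * (norm (w k))\<^sup>2 * norm (y - z)" if "k \<in> K" for k
  proof -
    have "0 \<le> c k"
      using lip[OF that, of 0 1] by (simp add: order_trans[OF abs_ge_zero])
    have "\<bar>\<Delta> k\<bar> \<le> c k * \<bar>w k \<bullet> (y - z)\<bar>"
      using lip[OF that, of "w k \<bullet> y - \<beta> k" "w k \<bullet> z - \<beta> k"]
      by (simp add: \<Delta>_def inner_diff_right)
    also have "\<dots> \<le> c k * (norm (w k) * norm (y - z))"
      using \<open>0 \<le> c k\<close> by (intro mult_left_mono Cauchy_Schwarz_ineq2)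
    finally have "\<bar>\<Delta> k\<bar> * norm (w k) \<le> c k * (norm (w k) * norm (y - z)) * norm (w k)"
      by (rule mult_right_mono) simp
    then show ?thesis
      by (simp add: power2_eq_square mult_ac)
  qed
  then have "norm (\<Sum>k\<in>K. \<Delta> k *\<^sub>R w k) \<le> (\<Sum>k\<in>K. c k * (norm (w k))\<^sup>2 * norm (y - z))"
    by (intro sum_norm_le)
  then show "norm (D y - D z) \<le> (\<Sum>k\<in>K. c k * (norm (w k))\<^sup>2) * norm (y - z)"
    unfolding D by (simp add: sum_distrib_right)
qed

text \<open>Instead of gluing derivatives at 0, the first-order remainder is bounded by
  \<open>h\<^sup>2\<close> for all signs of \<open>r\<close> and \<open>r + h\<close>.\<close>

lemma DERIV_negative_part_squared:
  "((\<lambda>r. (max 0 (- r))\<^sup>2) has_real_derivative - 2 * max 0 (- r)) (at r)"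
  for r :: real
  unfolding DERIV_def
proof (rule LIM_zero_cancel, rule Lim_null_comparison)
  have bound: "\<bar>(max 0 (- (r + h)))\<^sup>2 - (max 0 (- r))\<^sup>2 + 2 * max 0 (- r) * h\<bar> \<le> h\<^sup>2" for h
  proof -
    consider "r \<le> 0" "r + h \<le> 0" | "r \<le> 0" "r + h \<ge> 0" | "r \<ge> 0" "r + h \<ge> 0" | "r \<ge> 0" "r + h \<le> 0"
      by linarith
    then show ?thesis
    proof cases
      case 1
      then show ?thesis by (simp add: max_def power2_eq_square algebra_simps)
    next
      case 2
      \<comment> \<open>Here the remainder is \<open>(- r) * (r + 2 * h)\<close>, and
        \<open>h\<^sup>2\<close> exceeds it by \<open>(r + h)\<^sup>2\<close>.\<close>
      have "0 \<le> (- r) * (r + 2 * h)"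
        using 2 by (intro mult_nonneg_nonneg) auto
      moreover have "0 \<le> (r + h)\<^sup>2"
        by simp
      ultimately show ?thesis
        using 2 by (auto simp: max_def power2_eq_square algebra_simps)
    next
      case 3
      then have "max 0 (- (r + h)) = 0" "max 0 (- r) = 0"
        by auto
      then show ?thesis
        by (simp only:) simp
    next
      case 4
      have "(- (r + h))\<^sup>2 \<le> (- h)\<^sup>2"
        using 4 by (intro power_mono) auto
      moreover have "max 0 (- (r + h)) = - (r + h)" "max 0 (- r) = 0"
        using 4 by auto
      ultimately show ?thesis
        by (simp only: power2_minus) simp
    qed
  qed
  show "\<forall>\<^sub>F h in at 0. norm (((max 0 (- (r + h)))\<^sup>2 - (max 0 (- r))\<^sup>2) / h - - 2 * max 0 (- r)) \<le> \<bar>h\<bar>"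
    unfolding eventually_at_filter
  proof (intro always_eventually allI impI)
    fix h :: real
    assume "h \<noteq> 0"
    then have "((max 0 (- (r + h)))\<^sup>2 - (max 0 (- r))\<^sup>2) / h - - 2 * max 0 (- r)
        = ((max 0 (- (r + h)))\<^sup>2 - (max 0 (- r))\<^sup>2 + 2 * max 0 (- r) * h) / h"
      by (simp add: field_simps)
    also have "norm \<dots> \<le> h\<^sup>2 / \<bar>h\<bar>"
      using bound[of h] by (simp add: divide_right_mono)
    also have "\<dots> = \<bar>h\<bar>"
      using \<open>h \<noteq> 0\<close> by (simp add: power2_eq_square abs_if)
    finally show "norm (((max 0 (- (r + h)))\<^sup>2 - (max 0 (- r))\<^sup>2) / h - - 2 * max 0 (- r)) \<le> \<bar>h\<bar>" .
  qed
  show "((\<lambda>h::real. \<bar>h\<bar>) \<longlongrightarrow> 0) (at 0)"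
    by (auto intro!: tendsto_eq_intros)
qed

section \<open>Gradient and zero set of the penalty\<close>

lemma block_residual_squared: "(block_residual d A b i z)\<^sup>2 = (\<Sum>r<d i. (A i r \<bullet> z - b i r)\<^sup>2)"
  by (simp add: block_residual_def L2_set_def sum_nonneg)

lemma penalty_gradient:
  fixes A :: "'m::finite \<Rightarrow> nat \<Rightarrow> real^'n::finite"
  obtains c where "0 \<le> c"
    "\<And>z. GDERIV (penalty d A b J i) z :> gradient (penalty d A b J i) z"
    "\<And>y z. 0 \<le> (gradient (penalty d A b J i) y - gradient (penalty d A b J i) z) \<bullet> (y - z)"
    "\<And>y z. norm (gradient (penalty d A b J i) y - gradient (penalty d A b J i) z) \<le> c * norm (y - z)"
    "\<And>z. z \<in> feasible_set d A b J \<Longrightarrow> gradient (penalty d A b J i) z = 0"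
proof -
  let ?m = "real CARD('m)"
  \<comment> \<open>\<open>Inl\<close> indexes the rows of \<open>A i\<close> and \<open>Inr\<close>
    the sign constraints; for the latter the affine form is a coordinate, the inner product with
    \<open>axis j 1\<close>.\<close>
  define K :: "(nat + 'n) set" where "K = {..<d i} <+> J"
  define w where "w = case_sum (A i) (\<lambda>j. axis j (1::real))"
  define \<beta> :: "nat + 'n \<Rightarrow> real" where "\<beta> = case_sum (b i) (\<lambda>_. 0)"
  define \<psi> :: "nat + 'n \<Rightarrow> real \<Rightarrow> real" where
    "\<psi> = case_sum (\<lambda>_ r. 1 / 2 * r\<^sup>2) (\<lambda>_ r. 1 / (2 * ?m) * (max 0 (- r))\<^sup>2)"
  define s :: "nat + 'n \<Rightarrow> real \<Rightarrow> real" where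
    "s = case_sum (\<lambda>_ r. r) (\<lambda>_ r. - (1 / ?m) * max 0 (- r))"
  define c where "c = (\<Sum>k\<in>K. 1 * (norm (w k))\<^sup>2)"
  define D where "D z = (\<Sum>k\<in>K. s k (w k \<bullet> z - \<beta> k) *\<^sub>R w k)" for z
  have m: "1 \<le> ?m"
    by (simp add: Suc_leI)
  have deriv: "(\<psi> k has_real_derivative s k r) (at r)" for k r
  proof (cases k)
    case (Inl q)
    then show ?thesis
      by (auto simp: \<psi>_def s_def intro!: derivative_eq_intros)
  next
    case (Inr j)
    have "((\<lambda>r. 1 / (2 * ?m) * (max 0 (- r))\<^sup>2) has_real_derivative
        1 / (2 * ?m) * (- 2 * max 0 (- r))) (at r)"
      by (intro DERIV_cmult DERIV_negative_part_squared)
    with Inr show ?thesis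
      by (simp add: \<psi>_def s_def)
  qed
  have mono: "s k q \<le> s k r" if "q \<le> r" for k q r
    using that by (cases k) (auto simp: s_def intro!: divide_right_mono)
  have lip: "\<bar>s k q - s k r\<bar> \<le> 1 * \<bar>q - r\<bar>" for k q r
  proof (cases k)
    case (Inr j)
    have "s k q - s k r = (1 / ?m) * (max 0 (- r) - max 0 (- q))"
      using Inr by (simp add: s_def algebra_simps)
    also have "\<bar>\<dots>\<bar> \<le> 1 * \<bar>q - r\<bar>"
      unfolding abs_mult using m by (intro mult_mono) (auto simp: max_def)
    finally show ?thesis .
  qed (simp add: s_def)
  have pen: "penalty d A b J i z = (\<Sum>k\<in>K. \<psi> k (w k \<bullet> z - \<beta> k))" for z
    unfolding K_def by (subst sum.Plus)
      (auto simp: penalty_def block_residual_squared \<psi>_def w_def \<beta>_def inner_axis' sum_distrib_left)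
  note ridge = ridge_sum_gradient[where K = K and \<psi> = \<psi> and s = s and c = "\<lambda>_. 1" and w = w and \<beta> = \<beta>,
      OF deriv mono lip, folded D_def]
  have grad: "GDERIV (penalty d A b J i) z :> D z" for z
    using ridge(1)[of z] by (simp add: pen[abs_def])
  have eq: "gradient (penalty d A b J i) z = D z" for z
    by (rule gradient_eqI) (rule grad)
  show ?thesis
  proof
    show "0 \<le> c"
      by (simp add: c_def sum_nonneg)
    show "gradient (penalty d A b J i) z = 0" if "z \<in> feasible_set d A b J" for z
    proof -
      have "s k (w k \<bullet> z - \<beta> k) = 0" if "k \<in> K" for k
        using that \<open>z \<in> feasible_set d A b J\<close>
        by (auto simp: K_def s_def w_def \<beta>_def feasible_set_def inner_axis')
      then show ?thesis
        by (simp add: eq D_def)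
    qed
  qed (use grad ridge(2,3) in \<open>simp_all add: eq c_def\<close>)
qed

lemma penalty_ge:
  fixes A :: "'m::finite \<Rightarrow> nat \<Rightarrow> real^'n::finite"
  shows "(block_residual d A b i z)\<^sup>2 / 2 \<le> penalty d A b J i z"
  by (simp add: penalty_def sum_nonneg)

lemma penalty_eq_0_iff:
  fixes A :: "'m::finite \<Rightarrow> nat \<Rightarrow> real^'n::finite"
  shows "(\<forall>i. penalty d A b J i z = 0) \<longleftrightarrow> z \<in> feasible_set d A b J"
proof -
  have "penalty d A b J i z = 0 \<longleftrightarrow> (\<forall>r<d i. A i r \<bullet> z = b i r) \<and> (\<forall>j\<in>J. 0 \<le> z $ j)" for i
  proof -
    have "penalty d A b J i z = 0 \<longleftrightarrow>
        (\<Sum>r<d i. (A i r \<bullet> z - b i r)\<^sup>2) = 0 \<and> (\<Sum>j\<in>J. (max 0 (- (z $ j)))\<^sup>2) = 0"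
      unfolding penalty_def block_residual_squared
      by (subst add_nonneg_eq_0_iff) (auto simp: sum_nonneg)
    also have "\<dots> \<longleftrightarrow> (\<forall>r<d i. A i r \<bullet> z = b i r) \<and> (\<forall>j\<in>J. 0 \<le> z $ j)"
      by (subst (1 2) sum_nonneg_eq_0_iff) (auto simp: max_def)
    finally show ?thesis .
  qed
  then show ?thesis
    by (auto simp: feasible_set_def)
qed

lemma stacked_residual_squared:
  fixes A :: "'m::finite \<Rightarrow> nat \<Rightarrow> real^'n::finite"
  shows "(stacked_residual d A b z)\<^sup>2 = (\<Sum>i\<in>UNIV. (block_residual d A b i z)\<^sup>2)"
proof -
  have "(stacked_residual d A b z)\<^sup>2 = (\<Sum>(i, r)\<in>(SIGMA i:UNIV. {..<d i}). (A i r \<bullet> z - b i r)\<^sup>2)"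
    by (simp add: stacked_residual_def L2_set_def sum_nonneg case_prod_unfold)
  also have "\<dots> = (\<Sum>i\<in>UNIV. \<Sum>r<d i. (A i r \<bullet> z - b i r)\<^sup>2)"
    by (subst sum.Sigma) auto
  finally show ?thesis
    by (simp add: block_residual_squared)
qed

text \<open>A continuous function positive away from \<open>l\<close> has a positive minimum on the
  compact shell between radii \<open>e\<close> and \<open>\<rho>\<close>. Values tending to 0 fall
  below it, which keeps \<open>X\<close> out of the shell.\<close>

lemma tendsto_unique_zero:
  fixes \<Phi> :: "'a::heine_borel \<Rightarrow> real"
  assumes cont: "continuous_on UNIV \<Phi>" and zero: "\<And>z. \<Phi> z \<le> 0 \<Longrightarrow> z = l"
    and bounded: "\<forall>\<^sub>F k in F. dist (X k) l \<le> \<rho>" and lim: "((\<lambda>k. \<Phi> (X k)) \<longlongrightarrow> 0) F"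
  shows "(X \<longlongrightarrow> l) F"
proof (rule tendstoI)
  fix e :: real
  assume "0 < e"
  define S where "S = cball l \<rho> - ball l e"
  show "\<forall>\<^sub>F k in F. dist (X k) l < e"
  proof (cases "S = {}")
    case True
    then have "dist z l < e" if "dist z l \<le> \<rho>" for z
      using that by (auto simp: S_def dist_commute)
    with bounded show ?thesis
      by (auto elim: eventually_mono)
  next
    case False
    have "compact S"
      unfolding S_def by (rule compact_diff) auto
    then obtain z where z: "z \<in> S" "\<And>y. y \<in> S \<Longrightarrow> \<Phi> z \<le> \<Phi> y"
      using continuous_attains_inf[of S \<Phi>] False cont continuous_on_subset by blast
    have "0 < \<Phi> z"
      using zero[of z] z(1) \<open>0 < e\<close> by (force simp: S_def)
    then have "\<forall>\<^sub>F k in F. \<Phi> (X k) < \<Phi> z"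
      using lim by (rule order_tendstoD(2)[rotated])
    with bounded show ?thesis
    proof eventually_elim
      case (elim k)
      then show ?case
        using z(2)[of "X k"] by (force simp: S_def dist_commute)
    qed
  qed
qed

section \<open>Norms of matrices\<close>

lemma column_add: "column j (X + Y) = column j X + column j Y"
  by (simp add: column_def vec_eq_iff)

lemma column_diff: "column j (X - Y) = column j X - column j Y"
  by (simp add: column_def vec_eq_iff)

lemma column_mult: "column j (M ** X) = M *v column j X"
  by (simp add: column_def matrix_matrix_mult_def matrix_vector_mult_def vec_eq_iff)

lemma vector_norm_minus:
  assumes "vector_norm N"
  shows "N (v - w) \<le> N v + N w"
proof -
  have "N (v + (-1) *\<^sub>R w) \<le> N v + N ((-1) *\<^sub>R w)"
    using assms unfolding vector_norm_def by blast
  moreover have "N ((-1) *\<^sub>R w) = \<bar>-1\<bar> * N w"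
    using assms unfolding vector_norm_def by blast
  ultimately show ?thesis
    by simp
qed

lemma ext_norm_nonneg: "0 \<le> ext_norm N X"
  by (simp add: ext_norm_def)

lemma ext_norm_mono:
  assumes "vector_norm N" "\<And>j. N (column j X) \<le> c * N' (column j Y)" "0 \<le> c"
  shows "ext_norm N X \<le> c * ext_norm N' Y"
proof -
  have "ext_norm N X \<le> norm (c *\<^sub>R (\<chi> j. N' (column j Y)))"
    unfolding ext_norm_def
  proof (rule norm_le_componentwise_cart)
    fix j
    have "0 \<le> N (column j X)"
      using assms(1) by (simp add: vector_norm_def)
    then show "norm ((\<chi> j. N (column j X)) $ j) \<le> norm ((c *\<^sub>R (\<chi> j. N' (column j Y))) $ j)"
      using assms(2)[of j] by simp
  qed
  then show ?thesis
    using assms(3) by (simp add: ext_norm_def)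
qed

lemma ext_norm_triangle:
  assumes "vector_norm N"
  shows "ext_norm N (X + Y) \<le> ext_norm N X + ext_norm N Y"
    and "ext_norm N (X - Y) \<le> ext_norm N X + ext_norm N Y"
proof -
  have "ext_norm N Z \<le> ext_norm N X + ext_norm N Y"
    if Z: "\<And>j. N (column j Z) \<le> N (column j X) + N (column j Y)" for Z
  proof -
    have "ext_norm N Z \<le> norm ((\<chi> j. N (column j X)) + (\<chi> j. N (column j Y)))"
      unfolding ext_norm_def
    proof (rule norm_le_componentwise_cart)
      fix j
      have "0 \<le> N (column j Z)"
        using assms(1) by (simp add: vector_norm_def)
      then show "norm ((\<chi> j. N (column j Z)) $ j)
          \<le> norm (((\<chi> j. N (column j X)) + (\<chi> j. N (column j Y))) $ j)"
        using Z[of j] by simp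
    qed
    also have "\<dots> \<le> ext_norm N X + ext_norm N Y"
      unfolding ext_norm_def by (rule norm_triangle_ineq)
    finally show ?thesis .
  qed
  moreover have "N (column j (X + Y)) \<le> N (column j X) + N (column j Y)" for j
    using assms by (simp add: vector_norm_def column_add)
  moreover have "N (column j (X - Y)) \<le> N (column j X) + N (column j Y)" for j
    using assms by (simp add: vector_norm_minus column_diff)
  ultimately show "ext_norm N (X + Y) \<le> ext_norm N X + ext_norm N Y"
    and "ext_norm N (X - Y) \<le> ext_norm N X + ext_norm N Y"
    by blast+
qed

text \<open>Both sides are the Frobenius norm, summed by columns on the left and by rows in the norm
  of the type. This turns hypotheses about \<open>ext_norm norm\<close> into statements about
  \<open>norm\<close>.\<close>

lemma ext_norm_norm: "ext_norm norm X = norm X"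
proof -
  have "(ext_norm norm X)\<^sup>2 = (\<Sum>j\<in>UNIV. \<Sum>i\<in>UNIV. (X $ i $ j)\<^sup>2)"
    by (simp add: ext_norm_def norm_vec_def L2_set_def column_def sum_nonneg)
  also have "\<dots> = (\<Sum>i\<in>UNIV. \<Sum>j\<in>UNIV. (X $ i $ j)\<^sup>2)"
    by (rule sum.swap)
  also have "\<dots> = (norm X)\<^sup>2"
    by (simp add: norm_vec_def L2_set_def sum_nonneg)
  finally show ?thesis
    by (simp add: ext_norm_nonneg)
qed

lemma vector_norm_le_norm:
  fixes N :: "real^'m::finite \<Rightarrow> real"
  assumes N: "vector_norm N"
  obtains c where "0 \<le> c" "\<And>v. N v \<le> c * norm v"
proof
  have N0: "N 0 = 0" and nonneg: "0 \<le> N v" and tri: "N (v + w) \<le> N v + N w"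
    and scale: "N (c *\<^sub>R v) = \<bar>c\<bar> * N v" for v w c
    using N by (auto simp: vector_norm_def)
  show "0 \<le> (\<Sum>i\<in>UNIV. N (axis i 1))"
    using nonneg by (simp add: sum_nonneg)
  fix v
  have "N (\<Sum>i\<in>I. v $ i *\<^sub>R axis i 1) \<le> (\<Sum>i\<in>I. N (axis i 1)) * norm v" if "finite I" for I
    using that
  proof induction
    case (insert i I)
    have "N (v $ i *\<^sub>R axis i 1) \<le> norm v * N (axis i 1)"
      unfolding scale using component_le_norm_cart[of v i] nonneg by (intro mult_right_mono) auto
    then show ?case
      using insert tri[of "v $ i *\<^sub>R axis i 1" "\<Sum>i\<in>I. v $ i *\<^sub>R axis i 1"]
      by (simp add: algebra_simps)
  qed (simp add: N0)
  moreover have "(\<Sum>i\<in>UNIV. v $ i *\<^sub>R axis i 1) = v"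
    using basis_expansion[of v] by (simp add: scalar_mult_eq_scaleR)
  ultimately show "N v \<le> (\<Sum>i\<in>UNIV. N (axis i 1)) * norm v"
    using finite by metis
qed

text \<open>Test the hypothesis on a matrix whose only nonzero column is \<open>v\<close>: there
  \<open>ext_norm\<close> of any vector norm returns the norm of \<open>v\<close>.\<close>

lemma norm_le_vector_norm:
  fixes N :: "real^'m::finite \<Rightarrow> real"
  assumes N: "vector_norm N" and le: "\<And>W :: real^'n::finite^'m. ext_norm norm W \<le> ext_norm N W"
  shows "norm v \<le> N v"
proof -
  obtain j0 :: 'n where True by simp
  define W :: "real^'n^'m" where "W = (\<chi> i j. if j = j0 then v $ i else 0)"
  have col: "column j W = (if j = j0 then v else 0)" for j
    by (auto simp: column_def W_def vec_eq_iff)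
  have "ext_norm M W = M v" if "vector_norm M" for M
  proof -
    have "(\<chi> j. M (column j W)) = M v *\<^sub>R axis j0 1"
      using that by (auto simp: col vector_norm_def axis_def vec_eq_iff)
    then show ?thesis
      using that by (simp add: ext_norm_def vector_norm_def)
  qed
  moreover have "vector_norm (norm :: real^'m \<Rightarrow> real)"
    by (simp add: vector_norm_def norm_triangle_ineq)
  ultimately show ?thesis
    using le[of W] N by metis
qed

text \<open>The supremum in \<open>induced_norm\<close> is informative only if the quotients are
  bounded above; equivalence with the Euclidean norm provides this.\<close>

lemma induced_norm_contraction:
  fixes N :: "real^'m::finite \<Rightarrow> real" and M :: "real^'m^'m" and X :: "real^'n::finite^'m"
  assumes N: "vector_norm N" and le: "\<And>v. norm v \<le> N v"
  shows "0 \<le> induced_norm N M" "ext_norm N (M ** X) \<le> induced_norm N M * ext_norm N X"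
proof -
  have nonneg: "0 \<le> N v" and zero: "N v = 0 \<longleftrightarrow> v = 0" for v
    using N by (auto simp: vector_norm_def)
  obtain c where c: "0 \<le> c" "\<And>v. N v \<le> c * norm v"
    using vector_norm_le_norm[OF N] by blast
  obtain B where B: "0 < B" "\<And>v. norm (M *v v) \<le> B * norm v"
    using linear_bounded_pos[OF matrix_vector_mul_linear] by blast
  have "N (M *v v) / N v \<le> c * B" for v
  proof (cases "v = 0")
    case False
    have "N (M *v v) \<le> c * (B * norm v)"
      using c(2) mult_left_mono[OF B(2) c(1)] by (rule order_trans)
    also have "\<dots> \<le> c * (B * N v)"
      using le c(1) B(1) by (intro mult_left_mono) auto
    finally show ?thesis
      using False nonneg[of v] zero[of v] by (simp add: field_simps)
  qed (use c B zero in simp)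
  then have bdd: "bdd_above (range (\<lambda>v. N (M *v v) / N v))"
    by (rule bdd_aboveI2)
  then have upper: "N (M *v v) / N v \<le> induced_norm N M" for v
    unfolding induced_norm_def by (rule cSUP_upper[OF UNIV_I])
  \<comment> \<open>The quotient at \<open>v = 0\<close> is \<open>0 / 0 = 0\<close>, one of the
    values under the supremum.\<close>
  show ge0: "0 \<le> induced_norm N M"
    using upper[of 0] zero by simp
  have "N (M *v v) \<le> induced_norm N M * N v" for v
    using upper[of v] nonneg[of v] zero[of v] zero[of 0] by (cases "v = 0") (auto simp: field_simps)
  then show "ext_norm N (M ** X) \<le> induced_norm N M * ext_norm N X"
    using N ge0 by (intro ext_norm_mono) (auto simp: column_mult)
qed

lemma matrix_mult_norm_bound:
  fixes M :: "real^'k::finite^'m::finite"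
  obtains B where "0 \<le> B" "\<And>X :: real^'n::finite^'k. norm (M ** X) \<le> B * norm X"
proof -
  have "linear (\<lambda>X :: real^'n^'k. M ** X)"
    by (rule linearI) (simp_all add: matrix_add_ldistrib matrix_matrix_mult_def vec_eq_iff
        sum_distrib_left distrib_left sum.distrib mult_ac)
  then obtain B where "0 < B" "\<And>X :: real^'n^'k. norm (M ** X) \<le> B * norm X"
    using linear_bounded_pos by blast
  then show ?thesis
    using that[of B] by simp
qed

lemma diag_mat_mult_nth: "(diag_mat g ** X) $ i = g $ i *\<^sub>R X $ i"
  by (simp add: diag_mat_def matrix_matrix_mult_def vec_eq_iff if_distrib if_distribR cong: if_cong)

lemma max_step_ge: "g $ i \<le> max_step g"
  by (simp add: max_step_def)

lemma norm_diag_mat_mult_le: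
  assumes "\<And>i. 0 \<le> g $ i"
  shows "norm (diag_mat g ** X) \<le> max_step g * norm X"
proof -
  have ge0: "0 \<le> max_step g"
    using assms max_step_ge order_trans by blast
  have "norm (diag_mat g ** X) \<le> norm (max_step g *\<^sub>R X)"
  proof (rule norm_le_componentwise_cart)
    fix i
    show "norm ((diag_mat g ** X) $ i) \<le> norm ((max_step g *\<^sub>R X) $ i)"
      using assms[of i] max_step_ge[of g i] ge0 by (simp add: diag_mat_mult_nth mult_right_mono)
  qed
  then show ?thesis
    using ge0 by simp
qed

section \<open>Weighted averages and rank-one matrices\<close>

lemma weighted_avg_eq_sum:
  fixes w :: "real^'m::finite"
  shows "weighted_avg w X = (1 / real CARD('m)) *\<^sub>R (\<Sum>i\<in>UNIV. w $ i *\<^sub>R X $ i)"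
  by (simp add: weighted_avg_def vector_matrix_mult_def vec_eq_iff mult.commute)

lemma weighted_avg_linear:
  "weighted_avg w (X + Y) = weighted_avg w X + weighted_avg w Y"
  "weighted_avg w (X - Y) = weighted_avg w X - weighted_avg w Y"
  by (simp_all add: weighted_avg_eq_sum scaleR_add_right scaleR_diff_right sum.distrib sum_subtractf)

lemma weighted_avg_mult:
  "w v* M = w \<Longrightarrow> weighted_avg w (M ** X) = weighted_avg w X"
  by (simp add: weighted_avg_def flip: vector_matrix_mul_assoc)

lemma weighted_avg_outer:
  fixes w :: "real^'m::finite"
  shows "weighted_avg w (outer v z) = ((w \<bullet> v) / real CARD('m)) *\<^sub>R z"
  by (simp add: weighted_avg_eq_sum outer_def vec_eq_iff inner_vec_def sum_distrib_right mult.assoc)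

lemma norm_weighted_avg_le:
  fixes w :: "real^'m::finite"
  shows "norm (weighted_avg w X) \<le> norm w * norm X"
proof -
  have "norm (\<Sum>i\<in>UNIV. w $ i *\<^sub>R X $ i) \<le> (\<Sum>i\<in>UNIV. \<bar>w $ i\<bar> * \<bar>norm (X $ i)\<bar>)"
    by (rule order_trans[OF norm_sum]) simp
  also have "\<dots> \<le> norm w * norm X"
    unfolding norm_vec_def[of w] norm_vec_def[of X] using L2_set_mult_ineq[of "\<lambda>i. w $ i" "\<lambda>i. norm (X $ i)" UNIV]
    by (simp add: L2_set_def)
  finally have "norm (\<Sum>i\<in>UNIV. w $ i *\<^sub>R X $ i) \<le> norm w * norm X" .
  moreover have "norm (weighted_avg w X) \<le> 1 * norm (\<Sum>i\<in>UNIV. w $ i *\<^sub>R X $ i)"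
    unfolding weighted_avg_eq_sum norm_scaleR by (intro mult_right_mono) (auto simp: Suc_leI)
  ultimately show ?thesis
    by simp
qed

lemma norm_weighted_avg_one_le:
  assumes "\<And>i. norm (X $ i) \<le> c"
  shows "norm (weighted_avg 1 (X :: real^'n::finite^'m::finite)) \<le> c"
proof -
  have "norm (\<Sum>i\<in>UNIV. X $ i) \<le> real CARD('m) * c"
    using assms by (intro sum_norm_bound)
  then show ?thesis
    by (simp add: weighted_avg_eq_sum field_simps)
qed

lemma norm_outer: "norm (outer v z) = norm v * norm z"
proof -
  have row: "outer v z $ i = v $ i *\<^sub>R z" for i
    by (simp add: outer_def vec_eq_iff)
  show ?thesis
    unfolding norm_vec_def[of "outer v z"] norm_vec_def[of v] row
    by (simp add: L2_set_left_distrib)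
qed

lemma matrix_mult_outer: "M ** outer v z = outer (M *v v) z"
  by (simp add: outer_def matrix_matrix_mult_def matrix_vector_mult_def vec_eq_iff
      sum_distrib_right mult.assoc)

text \<open>So the matrices in the contraction hypotheses mix the rows and then subtract multiples
  of their weighted average, which is the form of the consensus and tracking errors.\<close>

lemma rank_one_mult:
  "((1 / real CARD('m)) *\<^sub>R outer v w) ** (X :: real^'n::finite^'m::finite) = outer v (weighted_avg w X)"
  by (simp add: outer_def weighted_avg_def vector_matrix_mult_def matrix_matrix_mult_def vec_eq_iff
      sum_distrib_left mult_ac)

lemma matrix_diff_distrib:
  fixes M M' :: "real^'k^'m"
  shows "M ** (X - Y) = M ** X - M ** Y" "(M - M') ** X = M ** X - M' ** X"
  by (simp_all add: matrix_matrix_mult_def vec_eq_iff algebra_simps sum_subtractf)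

lemma diag_mat_mult_vec_nth: "(diag_mat g *v v) $ i = g $ i * v $ i"
  by (simp add: diag_mat_def matrix_vector_mult_def if_distrib if_distribR cong: if_cong)

section \<open>Error recursions of the iteration\<close>

text \<open>Isolates the dynamics, with general exponents: gradients enter through monotonicity and
  Lipschitz bounds, mixing through eigenvector identities and contraction estimates. A single
  \<open>L\<close>, \<open>\<sigma>\<close> and \<open>cN\<close> serve both families of functions
  or both norms.\<close>

locale push_pull_tracking =
  fixes R C :: "real^'m::finite^'m" and u \<nu> :: "real^'m"
    and f g :: "'m \<Rightarrow> real^'n::finite \<Rightarrow> real"
    and NR NC :: "real^'m \<Rightarrow> real"
    and \<gamma> :: "nat \<Rightarrow> real^'m" and lam :: "nat \<Rightarrow> real"
    and x y :: "nat \<Rightarrow> real^'n^'m" and xs :: "real^'n"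
    and \<mu> L \<sigma> cN a b :: real
  assumes \<mu>: "0 < \<mu>" and L: "0 \<le> L"
    and f_mono: "\<And>i z w. \<mu> * (norm (z - w))\<^sup>2 \<le> (gradient (f i) z - gradient (f i) w) \<bullet> (z - w)"
    and f_lip: "\<And>i z w. norm (gradient (f i) z - gradient (f i) w) \<le> L * norm (z - w)"
    and g_mono: "\<And>i z w. 0 \<le> (gradient (g i) z - gradient (g i) w) \<bullet> (z - w)"
    and g_lip: "\<And>i z w. norm (gradient (g i) z - gradient (g i) w) \<le> L * norm (z - w)"
    and g_xs: "\<And>i. gradient (g i) xs = 0"
    and R_one: "R *v 1 = 1" and u_R: "u v* R = u" and u_one: "u \<bullet> 1 = real CARD('m)"
    and one_C: "1 v* C = 1" and C_\<nu>: "C *v \<nu> = \<nu>" and one_\<nu>: "1 \<bullet> \<nu> = real CARD('m)"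
    and NR: "vector_norm NR" and NC: "vector_norm NC"
    and \<sigma>: "0 \<le> \<sigma>" "\<sigma> < 1" and cN: "0 \<le> cN"
    and contr_R: "\<And>X :: real^'n^'m.
      ext_norm NR ((R - (1 / real CARD('m)) *\<^sub>R outer 1 u) ** X) \<le> \<sigma> * ext_norm NR X"
    and contr_C: "\<And>X :: real^'n^'m.
      ext_norm NC ((C - (1 / real CARD('m)) *\<^sub>R outer \<nu> 1) ** X) \<le> \<sigma> * ext_norm NC X"
    and le_NR: "\<And>X :: real^'n^'m. norm X \<le> ext_norm NR X"
    and le_NC: "\<And>X :: real^'n^'m. norm X \<le> ext_norm NC X"
    and NR_le: "\<And>X :: real^'n^'m. ext_norm NR X \<le> cN * norm X"
    and NC_le: "\<And>X :: real^'n^'m. ext_norm NC X \<le> cN * norm X"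
    and steps: "update_rule u \<nu> a b \<gamma> lam"
    and iter: "push_pull R C f g \<gamma> lam x y"
begin

definition xbar where "xbar k = weighted_avg u (x k)"
definition ybar where "ybar k = weighted_avg 1 (y k)"
definition gam where "gam k = max_step (\<gamma> k)"
definition ex where "ex k = ext_norm NR (x k - outer 1 (xbar k))"
definition ey where "ey k = ext_norm NC (y k - outer \<nu> (ybar k))"
text \<open>The mean, not the sum, of the gradients, because the mean is what \<open>ybar\<close>
  tracks.\<close>

definition Gf where "Gf z = weighted_avg 1 (\<chi> i. gradient (f i) z)"
definition Gg where "Gg z = weighted_avg 1 (\<chi> i. gradient (g i) z)"
definition G where "G l z = Gg z + l *\<^sub>R Gf z"
definition H where "H l X = row_gradients g X + l *\<^sub>R row_gradients f X"
text \<open>A common Lipschitz constant of \<open>H l\<close> and \<open>G l\<close> for all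
  \<open>l\<close> between 0 and \<open>lam 0\<close>.\<close>

definition M where "M = L + lam 0 * L"

section \<open>Step sizes and regularisation parameters\<close>

lemma exponents: "0 < b" "b < a" "a + b < 1" "a < 1" "b < 1"
  using steps by (auto simp: update_rule_def)

lemma gam_eq: "gam k = gam 0 / (real k + 1) powr a"
  and gam0: "0 < gam 0" and \<gamma>_nonneg: "0 \<le> \<gamma> k $ i"
  using steps unfolding update_rule_def gam_def by blast+

lemma gam_pos: "0 < gam k"
  using gam0 gam_eq[of k] by simp

lemma lam_eq: "lam k = lam 0 / (real k + 1) powr b" and lam0: "0 < lam 0"
  using steps unfolding update_rule_def by blast+

lemma lam_pos: "0 < lam k"
  using lam0 lam_eq[of k] by simp

lemma lam_dec: "lam (Suc k) \<le> lam k"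
  unfolding lam_eq[of k] lam_eq[of "Suc k"] using lam0 exponents
  by (intro divide_left_mono powr_mono2) auto

lemma lam_le: "lam k \<le> lam 0"
  using lam_dec by (induction k) (auto intro: order_trans)

text \<open>As \<open>b < 1\<close>, the power \<open>b\<close> of the base
  \<open>(k + 2) / (k + 1)\<close> is at most the base. The decrease is measured against
  \<open>lam (Suc k)\<close> because \<open>p_drift\<close> divides by that modulus.\<close>

lemma lam_diff: "lam k - lam (Suc k) \<le> lam (Suc k) / (real k + 1)"
proof -
  have "((real k + 2) / (real k + 1)) powr b \<le> ((real k + 2) / (real k + 1)) powr 1"
    using exponents by (intro powr_mono) (auto simp: field_simps)
  then have "(real k + 2) powr b / (real k + 1) powr b \<le> 1 + 1 / (real k + 1)"
    by (simp add: powr_divide field_simps)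
  moreover have "lam k = lam (Suc k) * ((real k + 2) powr b / (real k + 1) powr b)"
    unfolding lam_eq[of k] lam_eq[of "Suc k"] by (simp add: add.commute)
  ultimately have "lam k \<le> lam (Suc k) * (1 + 1 / (real k + 1))"
    using lam_pos[of "Suc k"] by (metis less_imp_le mult_left_mono)
  then show ?thesis
    by (simp add: algebra_simps)
qed

text \<open>Lets \<open>drift_bound\<close> charge errors multiplied by \<open>1 / (k + 1)\<close>
  to the step size.\<close>

lemma inverse_le_gam: "1 / (real k + 1) \<le> gam k / gam 0"
proof -
  have "(real k + 1) powr a \<le> (real k + 1) powr 1"
    using exponents by (intro powr_mono) auto
  then show ?thesis
    unfolding gam_eq[of k] using gam0 by (simp add: field_simps)
qed

lemma M_nonneg: "0 \<le> M"
  using L lam0 by (simp add: M_def)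

section \<open>Lipschitz and monotonicity bounds for the averaged gradients\<close>

lemma G_eq: "G l z = weighted_avg 1 (H l (\<chi> i. z))"
  by (simp add: G_def Gg_def Gf_def H_def row_gradients_def weighted_avg_eq_sum sum.distrib
      scaleR_add_right scaleR_sum_right mult.commute)

lemma H_row_lip:
  assumes "0 \<le> l" "l \<le> lam 0"
  shows "norm (H l X $ i - H l Y $ i) \<le> M * norm (X $ i - Y $ i)"
proof -
  have "H l X $ i - H l Y $ i = (gradient (g i) (X $ i) - gradient (g i) (Y $ i))
      + l *\<^sub>R (gradient (f i) (X $ i) - gradient (f i) (Y $ i))"
    by (simp add: H_def row_gradients_def algebra_simps)
  also have "norm \<dots> \<le> L * norm (X $ i - Y $ i) + l * (L * norm (X $ i - Y $ i))"
    using assms g_lip f_lip by (intro norm_triangle_mono) (auto intro: mult_left_mono)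
  also have "\<dots> \<le> L * norm (X $ i - Y $ i) + lam 0 * (L * norm (X $ i - Y $ i))"
    using assms L by (intro add_left_mono mult_right_mono) auto
  finally show ?thesis
    by (simp add: M_def algebra_simps)
qed

lemma H_lip:
  assumes "0 \<le> l" "l \<le> lam 0"
  shows "norm (H l X - H l Y) \<le> M * norm (X - Y)"
proof -
  have "norm (H l X - H l Y) \<le> norm (M *\<^sub>R (X - Y))"
  proof (rule norm_le_componentwise_cart)
    fix i
    show "norm ((H l X - H l Y) $ i) \<le> norm ((M *\<^sub>R (X - Y)) $ i)"
      using H_row_lip[OF assms, of X i Y] M_nonneg by simp
  qed
  then show ?thesis
    using M_nonneg by simp
qed

text \<open>Applied with \<open>z = p k\<close>, where \<open>G (lam k)\<close> vanishes, to bound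
  \<open>ybar\<close>, and with \<open>z = xbar k\<close> to compare \<open>ybar\<close> with the
  exact gradient step.\<close>

lemma weighted_H_lip:
  assumes "0 \<le> l" "l \<le> lam 0" "\<And>i. norm (X $ i - z) \<le> r"
  shows "norm (weighted_avg 1 (H l X) - G l z) \<le> M * r"
proof -
  have "norm (weighted_avg 1 (H l X - H l (\<chi> i. z))) \<le> M * r"
  proof (rule norm_weighted_avg_one_le)
    fix i
    have "norm ((H l X - H l (\<chi> i. z)) $ i) \<le> M * norm (X $ i - z)"
      using H_row_lip[OF assms(1,2), of X i "\<chi> i. z"] by simp
    also have "\<dots> \<le> M * r"
      using assms(3) M_nonneg by (intro mult_left_mono) auto
    finally show "norm ((H l X - H l (\<chi> i. z)) $ i) \<le> M * r" .
  qed
  then show ?thesis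
    by (simp add: G_eq weighted_avg_linear)
qed

lemma G_lip:
  assumes "0 \<le> l" "l \<le> lam 0"
  shows "norm (G l z - G l w) \<le> M * norm (z - w)"
  using weighted_H_lip[OF assms, of "\<chi> i. z" w "norm (z - w)"] by (simp add: G_eq)

lemma Gf_lip: "norm (Gf z - Gf w) \<le> L * norm (z - w)"
  unfolding Gf_def weighted_avg_linear(2)[symmetric]
  by (rule norm_weighted_avg_one_le) (use f_lip in simp)

lemma inner_weighted_avg_one:
  "weighted_avg 1 X \<bullet> v = (1 / real CARD('m)) * (\<Sum>i\<in>UNIV. X $ i \<bullet> v)"
  for X :: "real^'n^'m"
  by (simp add: weighted_avg_eq_sum inner_sum_left)

lemma Gf_mono: "\<mu> * (norm (z - w))\<^sup>2 \<le> (Gf z - Gf w) \<bullet> (z - w)"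
proof -
  have "real CARD('m) * (\<mu> * (norm (z - w))\<^sup>2)
      \<le> (\<Sum>i\<in>UNIV. (gradient (f i) z - gradient (f i) w) \<bullet> (z - w))"
    using f_mono by (intro sum_bounded_below) simp
  then show ?thesis
    unfolding Gf_def weighted_avg_linear(2)[symmetric] inner_weighted_avg_one
    by (simp add: field_simps)
qed

lemma Gg_mono: "0 \<le> (Gg z - Gg w) \<bullet> (z - w)"
  unfolding Gg_def weighted_avg_linear(2)[symmetric] inner_weighted_avg_one
  by (simp add: g_mono sum_nonneg)

lemma Gg_xs: "Gg xs = 0"
  by (simp add: Gg_def g_xs weighted_avg_eq_sum)

lemma G_mono:
  assumes "0 \<le> l"
  shows "l * \<mu> * (norm (z - w))\<^sup>2 \<le> (G l z - G l w) \<bullet> (z - w)"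
proof -
  have "(G l z - G l w) \<bullet> (z - w) = (Gg z - Gg w) \<bullet> (z - w) + l * ((Gf z - Gf w) \<bullet> (z - w))"
    by (simp add: G_def algebra_simps)
  then show ?thesis
    using Gg_mono[of z w] mult_left_mono[OF Gf_mono[of z w] assms] by (simp add: mult.assoc)
qed

section \<open>The path of regularised minimisers\<close>

definition p where "p k = (SOME z. G (lam k) z = 0)"

lemma G_p: "G (lam k) (p k) = 0"
proof -
  have "\<exists>z. G (lam k) z = 0"
    by (rule strongly_monotone_has_zero[of "lam k * \<mu>" "G (lam k)" M])
      (use G_mono G_lip lam_pos[of k] lam_le \<mu> in \<open>auto simp: less_imp_le\<close>)
  then show ?thesis
    unfolding p_def by (rule someI_ex)
qed

text \<open>\<open>Gg\<close> is monotone and vanishes at \<open>xs\<close>, so at a zero of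
  \<open>Gg + lam k * Gf\<close> the inner product of \<open>Gf (p k)\<close> with
  \<open>p k - xs\<close> cannot be positive. Strong monotonicity of \<open>Gf\<close> alone then
  bounds the distance, so \<open>lam k\<close> does not enter.\<close>

lemma p_bound: "norm (p k - xs) \<le> norm (Gf xs) / \<mu>"
proof -
  let ?d = "p k - xs"
  have "0 = G (lam k) (p k) \<bullet> ?d"
    by (simp add: G_p)
  also have "\<dots> = (Gg (p k) - Gg xs) \<bullet> ?d + lam k * (Gf (p k) \<bullet> ?d)"
    by (simp add: G_def Gg_xs inner_add_left)
  finally have "lam k * (Gf (p k) \<bullet> ?d) \<le> 0"
    using Gg_mono[of "p k" xs] by linarith
  then have "Gf (p k) \<bullet> ?d \<le> 0"
    using lam_pos[of k] by (simp add: mult_le_0_iff)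
  then have "\<mu> * (norm ?d)\<^sup>2 \<le> - (Gf xs \<bullet> ?d)"
    using Gf_mono[of "p k" xs] by (simp add: inner_diff_left)
  also have "\<dots> \<le> norm (Gf xs) * norm ?d"
    using Cauchy_Schwarz_ineq2[of "Gf xs" ?d] by linarith
  finally have "(\<mu> * norm ?d) * norm ?d \<le> norm (Gf xs) * norm ?d"
    by (simp add: power2_eq_square mult.assoc)
  then have "\<mu> * norm ?d \<le> norm (Gf xs)"
    by (cases "?d = 0") auto
  then show ?thesis
    using \<mu> by (simp add: field_simps)
qed

text \<open>The numerator bounds \<open>Gf\<close> along the path, by \<open>p_bound\<close> and the
  Lipschitz estimate.\<close>

definition cp where "cp = (norm (Gf xs) + L * (norm (Gf xs) / \<mu>)) / \<mu>"

text \<open>\<open>p k\<close> solves the equation of \<open>p (Suc k)\<close> up to the defect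
  \<open>(lam k - lam (Suc k)) *\<^sub>R Gf (p k)\<close>. Strong monotonicity divides it by
  \<open>lam (Suc k) * \<mu>\<close>, and \<open>lam_diff\<close> cancels
  \<open>lam (Suc k)\<close>.\<close>

lemma p_drift: "norm (p (Suc k) - p k) \<le> cp / (real k + 1)"
proof -
  let ?d = "p (Suc k) - p k" and ?l = "lam (Suc k)"
  have Gf_p: "norm (Gf (p k)) \<le> norm (Gf xs) + L * (norm (Gf xs) / \<mu>)"
  proof -
    have "norm (Gf (p k)) \<le> norm (Gf xs) + norm (Gf (p k) - Gf xs)"
      using norm_triangle_ineq[of "Gf xs" "Gf (p k) - Gf xs"] by simp
    also have "norm (Gf (p k) - Gf xs) \<le> L * norm (p k - xs)"
      by (rule Gf_lip)
    also have "\<dots> \<le> L * (norm (Gf xs) / \<mu>)"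
      using p_bound L by (intro mult_left_mono) auto
    finally show ?thesis by simp
  qed
  have "G ?l (p k) = G (lam k) (p k) - (lam k - ?l) *\<^sub>R Gf (p k)"
    by (simp add: G_def algebra_simps)
  then have "?l * \<mu> * (norm ?d)\<^sup>2 \<le> ((lam k - ?l) *\<^sub>R Gf (p k)) \<bullet> ?d"
    using G_mono[of ?l "p (Suc k)" "p k"] lam_pos[of "Suc k"] by (simp add: G_p)
  also have "\<dots> \<le> norm ((lam k - ?l) *\<^sub>R Gf (p k)) * norm ?d"
    by (rule norm_cauchy_schwarz)
  also have "norm ((lam k - ?l) *\<^sub>R Gf (p k)) = (lam k - ?l) * norm (Gf (p k))"
    using lam_dec[of k] by simp
  finally have "(?l * \<mu> * norm ?d) * norm ?d \<le> ((lam k - ?l) * norm (Gf (p k))) * norm ?d"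
    by (simp add: power2_eq_square mult.assoc)
  then have "?l * \<mu> * norm ?d \<le> (lam k - ?l) * norm (Gf (p k))"
    using lam_dec[of k] by (cases "?d = 0") auto
  also have "\<dots> \<le> (?l / (real k + 1)) * (norm (Gf xs) + L * (norm (Gf xs) / \<mu>))"
    using lam_diff[of k] Gf_p lam_pos[of "Suc k"] by (intro mult_mono) auto
  finally have "?l * (\<mu> * norm ?d) \<le> ?l * ((norm (Gf xs) + L * (norm (Gf xs) / \<mu>)) / (real k + 1))"
    by (simp add: mult.assoc)
  then have "\<mu> * norm ?d \<le> (norm (Gf xs) + L * (norm (Gf xs) / \<mu>)) / (real k + 1)"
    using lam_pos[of "Suc k"] by (simp only: mult_le_cancel_left_pos)
  then have "norm ?d \<le> (norm (Gf xs) + L * (norm (Gf xs) / \<mu>)) / (real k + 1) / \<mu>"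
    using \<mu> by (simp only: pos_le_divide_eq mult.commute)
  then show ?thesis
    by (simp add: cp_def mult.commute)
qed

definition t where "t k = norm (xbar k - p k)"

section \<open>Recursions for the consensus, tracking and optimality errors\<close>

lemma x_Suc: "x (Suc k) = R ** (x k - diag_mat (\<gamma> k) ** y k)"
  and y_Suc: "y (Suc k) = C ** y k + (H (lam (Suc k)) (x (Suc k)) - H (lam k) (x k))"
  and y_0: "y 0 = H (lam 0) (x 0)"
  using iter by (simp_all add: push_pull_def H_def algebra_simps)

text \<open>Gradient tracking: column-stochasticity of \<open>C\<close> telescopes the increments of \<open>y\<close>.\<close>

lemma ybar_eq: "ybar k = weighted_avg 1 (H (lam k) (x k))"
  by (induction k) (simp_all add: ybar_def y_0 y_Suc weighted_avg_linear weighted_avg_mult[OF one_C])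

lemma xbar_Suc_raw: "xbar (Suc k) = xbar k - weighted_avg u (diag_mat (\<gamma> k) ** y k)"
  by (simp add: xbar_def x_Suc weighted_avg_mult[OF u_R] weighted_avg_linear)

lemma ex_nonneg: "0 \<le> ex k" and ey_nonneg: "0 \<le> ey k" and t_nonneg: "0 \<le> t k"
  by (simp_all add: ex_def ey_def t_def ext_norm_nonneg)

lemma norm_x_dev: "norm (x k - outer 1 (xbar k)) \<le> ex k"
  unfolding ex_def by (rule le_NR)

lemma norm_y_dev: "norm (y k - outer \<nu> (ybar k)) \<le> ey k"
  unfolding ey_def by (rule le_NC)

lemma row_dev: "norm (x k $ i - xbar k) \<le> ex k"
proof -
  have "norm (x k $ i - xbar k) = norm ((x k - outer 1 (xbar k)) $ i)"
    by (simp add: outer_def vec_eq_iff norm_vec_def)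
  also have "\<dots> \<le> ex k"
    using norm_x_dev Finite_Cartesian_Product.norm_nth_le order_trans by blast
  finally show ?thesis .
qed

lemma row_dev_p: "norm (x k $ i - p k) \<le> ex k + t k"
  using norm_triangle_ineq[of "x k $ i - xbar k" "xbar k - p k"] row_dev[of k i]
  by (simp add: t_def)

lemma lam_range: "0 \<le> lam k" "lam k \<le> lam 0"
  using lam_pos[of k] lam_le[of k] by auto

text \<open>Comparison with \<open>p k\<close> makes the averaged direction proportional to the
  errors, so the steps leave no separate term of order \<open>gam\<close> in the recursions.\<close>

lemma ybar_bound: "norm (ybar k) \<le> M * (ex k + t k)"
  using weighted_H_lip[OF lam_range row_dev_p, of k k] by (simp add: ybar_eq G_p)

lemma ybar_G: "norm (ybar k - G (lam k) (xbar k)) \<le> M * ex k"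
  using weighted_H_lip[OF lam_range row_dev, of k k] by (simp add: ybar_eq)

definition cy where "cy = 1 + norm \<nu> * M"

lemma cy_nonneg: "0 \<le> cy"
  using M_nonneg by (simp add: cy_def)

lemma y_bound: "norm (y k) \<le> cy * (ex k + ey k + t k)"
proof -
  have "norm (y k) \<le> norm (y k - outer \<nu> (ybar k)) + norm (outer \<nu> (ybar k))"
    using norm_triangle_ineq[of "y k - outer \<nu> (ybar k)" "outer \<nu> (ybar k)"] by simp
  also have "\<dots> \<le> ey k + norm \<nu> * (M * (ex k + t k))"
    unfolding norm_outer using norm_y_dev ybar_bound by (intro add_mono mult_left_mono) auto
  also have "\<dots> \<le> cy * (ex k + ey k + t k)"
    using ex_nonneg[of k] ey_nonneg[of k] t_nonneg[of k] M_nonneg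
    by (simp add: cy_def algebra_simps)
  finally show ?thesis .
qed

lemma step_bound: "norm (diag_mat (\<gamma> k) ** y k) \<le> gam k * (cy * (ex k + ey k + t k))"
proof -
  have "norm (diag_mat (\<gamma> k) ** y k) \<le> gam k * norm (y k)"
    unfolding gam_def by (rule norm_diag_mat_mult_le) (rule \<gamma>_nonneg)
  also have "\<dots> \<le> gam k * (cy * (ex k + ey k + t k))"
    using gam_pos[of k] y_bound by (intro mult_left_mono) auto
  finally show ?thesis .
qed

lemma ex_step: "ex (Suc k) \<le> \<sigma> * ex k + cN * cy * gam k * (ex k + ey k + t k)"
proof -
  let ?J = "(1 / real CARD('m)) *\<^sub>R outer 1 u" and ?s = "diag_mat (\<gamma> k) ** y k"
  have "x (Suc k) - outer 1 (xbar (Suc k)) = (R - ?J) ** (x k - ?s)"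
    unfolding matrix_diff_distrib(2) rank_one_mult xbar_def
    by (simp add: x_Suc weighted_avg_mult[OF u_R])
  \<comment> \<open>\<open>R\<close> fixes the vector 1 and the weights \<open>u\<close> average to
    1, so consensus matrices are annihilated and the deviation may replace
    \<open>x k\<close>.\<close>
  also have "\<dots> = (R - ?J) ** (x k - outer 1 (xbar k) - ?s)"
  proof -
    have "(R - ?J) ** outer 1 (xbar k) = 0"
      unfolding matrix_diff_distrib(2) unfolding rank_one_mult unfolding matrix_mult_outer weighted_avg_outer
      by (simp add: R_one u_one)
    then show ?thesis
      by (simp add: matrix_diff_distrib(1))
  qed
  finally have "ex (Suc k) \<le> \<sigma> * ext_norm NR (x k - outer 1 (xbar k) - ?s)"
    unfolding ex_def using contr_R by simp
  also have "\<dots> \<le> \<sigma> * (ex k + ext_norm NR ?s)"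
    unfolding ex_def using \<sigma> ext_norm_triangle(2)[OF NR] by (intro mult_left_mono)
  also have "\<dots> \<le> \<sigma> * ex k + ext_norm NR ?s"
    using \<sigma> mult_right_mono[of \<sigma> 1 "ext_norm NR ?s"] ext_norm_nonneg[of NR ?s]
    by (simp add: distrib_left)
  also have "ext_norm NR ?s \<le> cN * (gam k * (cy * (ex k + ey k + t k)))"
    using NR_le[of ?s] mult_left_mono[OF step_bound[of k] cN] by linarith
  finally show ?thesis
    by (simp add: mult_ac)
qed

text \<open>Split the change into a move of \<open>x\<close> at fixed \<open>lam\<close>, controlled
  by \<open>M\<close>, and a change of \<open>lam\<close> at fixed \<open>x\<close>. The second is
  of order \<open>1 / (k + 1)\<close> times gradients of \<open>f\<close>, which themselves grow
  with the errors; that product is absorbed by the \<open>gam\<close> term.\<close>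

lemma drift_bound:
  obtains c where "0 \<le> c"
    "\<And>k. norm (H (lam (Suc k)) (x (Suc k)) - H (lam k) (x k))
      \<le> c * ex k + c * gam k * (ex k + ey k + t k) + c / (real k + 1)"
proof -
  obtain cR where cR: "0 \<le> cR" "\<And>X :: real^'n^'m. norm (R ** X) \<le> cR * norm X"
    by (rule matrix_mult_norm_bound[of R], rule that)
  define D where "D = (\<Sum>i\<in>UNIV. norm (gradient (f i) xs)) + real CARD('m) * (L * (norm (Gf xs) / \<mu>))"
  define mL where "mL = real CARD('m) * L"
  define c where "c = M * (cR + 1) + (M * cR * cy + lam 0 * mL / gam 0) + lam 0 * D"
  have nonneg: "0 \<le> D" "0 \<le> mL"
    using L \<mu> by (auto simp: D_def mL_def sum_nonneg)
  have parts: "0 \<le> M * (cR + 1)" "0 \<le> M * cR * cy + lam 0 * mL / gam 0" "0 \<le> lam 0 * D"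
    using nonneg M_nonneg cR(1) cy_nonneg lam0 gam0 by auto
  show ?thesis
  proof
    show "0 \<le> c"
      unfolding c_def using parts by linarith
    fix k
    let ?S = "ex k + ey k + t k" and ?l = "lam (Suc k)"
    have S: "0 \<le> ?S" "ex k + t k \<le> ?S"
      using ex_nonneg[of k] ey_nonneg[of k] t_nonneg[of k] by auto
    have dx: "norm (x (Suc k) - x k) \<le> (cR + 1) * ex k + cR * cy * gam k * ?S"
    proof -
      let ?E = "x k - outer 1 (xbar k)" and ?s = "diag_mat (\<gamma> k) ** y k"
      \<comment> \<open>\<open>R\<close> reproduces the consensus part, so only the deviation and
        the step move \<open>x\<close>. The deviation comes without a factor \<open>gam\<close>:
        hence \<open>c * ex\<close> in the recursion of \<open>ey\<close>.\<close>
      have eq: "x (Suc k) - x k = R ** ?E - ?E - R ** ?s"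
        by (simp add: x_Suc matrix_diff_distrib(1) matrix_mult_outer R_one)
      have "norm (x (Suc k) - x k) \<le> norm (R ** ?E) + norm ?E + norm (R ** ?s)"
        unfolding eq using norm_triangle_ineq4[of "R ** ?E - ?E" "R ** ?s"] norm_triangle_ineq4[of "R ** ?E" ?E]
        by linarith
      also have "\<dots> \<le> cR * ex k + ex k + cR * (gam k * (cy * ?S))"
        using cR(2)[of ?E] cR(2)[of ?s] mult_left_mono[OF norm_x_dev[of k] cR(1)]
          mult_left_mono[OF step_bound[of k] cR(1)] norm_x_dev[of k] by linarith
      finally show ?thesis
        by (simp add: algebra_simps)
    qed
    have rg: "norm (row_gradients f (x k)) \<le> D + mL * ?S"
    proof -
      have "norm (row_gradients f (x k) $ i) \<le> norm (gradient (f i) xs) + L * (?S + norm (Gf xs) / \<mu>)"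
        for i
      proof -
        have "norm (row_gradients f (x k) $ i)
            \<le> norm (gradient (f i) xs) + norm (gradient (f i) (x k $ i) - gradient (f i) xs)"
          using norm_triangle_ineq[of "gradient (f i) xs" "gradient (f i) (x k $ i) - gradient (f i) xs"]
          by (simp add: row_gradients_def)
        also have "norm (gradient (f i) (x k $ i) - gradient (f i) xs) \<le> L * norm (x k $ i - xs)"
          by (rule f_lip)
        also have "\<dots> \<le> L * (?S + norm (Gf xs) / \<mu>)"
          using norm_triangle_ineq[of "x k $ i - p k" "p k - xs"] row_dev_p[of k i] p_bound[of k] S L
          by (intro mult_left_mono) auto
        finally show ?thesis by simp
      qed
      then have "(\<Sum>i\<in>UNIV. norm (row_gradients f (x k) $ i))
          \<le> (\<Sum>i\<in>UNIV. norm (gradient (f i) xs) + L * (?S + norm (Gf xs) / \<mu>))"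
        by (rule sum_mono)
      also have "\<dots> = D + mL * ?S"
        by (simp add: sum.distrib D_def mL_def algebra_simps)
      finally show ?thesis
        unfolding norm_vec_def[of "row_gradients f (x k)"]
        using L2_set_le_sum[of UNIV "\<lambda>i. norm (row_gradients f (x k) $ i)"] by simp
    qed
    have dl: "lam k - ?l \<le> lam 0 / (real k + 1)"
      using lam_diff[of k] divide_right_mono[OF lam_le[of "Suc k"], of "real k + 1"] by simp
    have "H ?l (x (Suc k)) - H (lam k) (x k)
        = (H ?l (x (Suc k)) - H ?l (x k)) - (lam k - ?l) *\<^sub>R row_gradients f (x k)"
      by (simp add: H_def algebra_simps)
    then have "norm (H ?l (x (Suc k)) - H (lam k) (x k))
        \<le> norm (H ?l (x (Suc k)) - H ?l (x k)) + norm ((lam k - ?l) *\<^sub>R row_gradients f (x k))"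
      by (simp only: norm_triangle_ineq4)
    also have "norm (H ?l (x (Suc k)) - H ?l (x k)) \<le> M * ((cR + 1) * ex k + cR * cy * gam k * ?S)"
      using H_lip[OF lam_range[of "Suc k"], of "x (Suc k)" "x k"] mult_left_mono[OF dx M_nonneg]
      by linarith
    also have "norm ((lam k - ?l) *\<^sub>R row_gradients f (x k)) \<le> lam 0 / (real k + 1) * (D + mL * ?S)"
      unfolding norm_scaleR using lam_dec[of k] dl rg lam0 by (intro mult_mono) auto
    also have "\<dots> = lam 0 * D / (real k + 1) + lam 0 * (mL * ?S) * (1 / (real k + 1))"
      by (simp add: divide_inverse algebra_simps)
    also have "\<dots> \<le> lam 0 * D / (real k + 1) + lam 0 * (mL * ?S) * (gam k / gam 0)"
      using S nonneg lam0 inverse_le_gam[of k] by (intro add_left_mono mult_left_mono) auto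
    finally have "norm (H ?l (x (Suc k)) - H (lam k) (x k))
        \<le> (M * (cR + 1)) * ex k + (M * cR * cy + lam 0 * mL / gam 0) * (gam k * ?S)
          + (lam 0 * D) * (1 / (real k + 1))"
      by (simp add: algebra_simps)
    also have "\<dots> \<le> c * ex k + c * (gam k * ?S) + c * (1 / (real k + 1))"
      using parts ex_nonneg[of k] S gam_pos[of k]
      by (intro add_mono mult_right_mono) (auto simp: c_def)
    finally show "norm (H ?l (x (Suc k)) - H (lam k) (x k))
        \<le> c * ex k + c * gam k * ?S + c / (real k + 1)"
      by (simp add: mult.assoc)
  qed
qed

text \<open>\<open>C\<close> fixes \<open>\<nu>\<close>, so the contraction acts on the old tracking
  error alone; the gradient increment enters with \<open>\<nu>\<close> times its own mean removed,
  which costs the factor \<open>1 + norm \<nu>\<close>.\<close>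

lemma ey_step:
  "ey (Suc k) \<le> \<sigma> * ey k
    + cN * (1 + norm \<nu>) * norm (H (lam (Suc k)) (x (Suc k)) - H (lam k) (x k))"
proof -
  let ?K = "(1 / real CARD('m)) *\<^sub>R outer \<nu> 1"
  let ?\<Delta> = "H (lam (Suc k)) (x (Suc k)) - H (lam k) (x k)"
  have K: "(C - ?K) ** outer \<nu> (ybar k) = 0"
    unfolding matrix_diff_distrib(2) unfolding rank_one_mult unfolding matrix_mult_outer weighted_avg_outer
    by (simp add: C_\<nu> one_\<nu>)
  have "y (Suc k) - outer \<nu> (ybar (Suc k)) = C ** y k - outer \<nu> (ybar k)
      + (?\<Delta> - outer \<nu> (weighted_avg 1 ?\<Delta>))"
  proof -
    have "ybar (Suc k) = ybar k + weighted_avg 1 ?\<Delta>"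
      by (simp add: ybar_eq weighted_avg_linear)
    then have "outer \<nu> (ybar (Suc k)) = outer \<nu> (ybar k) + outer \<nu> (weighted_avg 1 ?\<Delta>)"
      by (simp add: outer_def vec_eq_iff distrib_left)
    then show ?thesis
      by (simp add: y_Suc)
  qed
  also have "C ** y k - outer \<nu> (ybar k) = (C - ?K) ** (y k - outer \<nu> (ybar k))"
    unfolding matrix_diff_distrib(1)[of "C - ?K"] K
    by (simp add: matrix_diff_distrib(2) rank_one_mult ybar_def)
  finally have "ey (Suc k) \<le> ext_norm NC ((C - ?K) ** (y k - outer \<nu> (ybar k)))
      + ext_norm NC (?\<Delta> - outer \<nu> (weighted_avg 1 ?\<Delta>))"
    unfolding ey_def using ext_norm_triangle(1)[OF NC] by simp
  also have "ext_norm NC ((C - ?K) ** (y k - outer \<nu> (ybar k))) \<le> \<sigma> * ey k"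
    unfolding ey_def by (rule contr_C)
  also have "ext_norm NC (?\<Delta> - outer \<nu> (weighted_avg 1 ?\<Delta>)) \<le> cN * ((1 + norm \<nu>) * norm ?\<Delta>)"
  proof -
    have "norm (weighted_avg 1 ?\<Delta>) \<le> norm ?\<Delta>"
      by (rule norm_weighted_avg_one_le) (rule Finite_Cartesian_Product.norm_nth_le)
    then have "norm (?\<Delta> - outer \<nu> (weighted_avg 1 ?\<Delta>)) \<le> norm ?\<Delta> + norm \<nu> * norm ?\<Delta>"
      using norm_triangle_ineq4[of ?\<Delta> "outer \<nu> (weighted_avg 1 ?\<Delta>)"]
        mult_left_mono[of "norm (weighted_avg 1 ?\<Delta>)" "norm ?\<Delta>" "norm \<nu>"]
      by (simp only: norm_outer) simp
    then have "norm (?\<Delta> - outer \<nu> (weighted_avg 1 ?\<Delta>)) \<le> (1 + norm \<nu>) * norm ?\<Delta>"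
      by (simp add: distrib_right)
    then show ?thesis
      using NC_le[of "?\<Delta> - outer \<nu> (weighted_avg 1 ?\<Delta>)"] mult_left_mono[OF _ cN] order_trans by blast
  qed
  finally show ?thesis
    by (simp add: mult.assoc)
qed

definition \<alpha> where "\<alpha> k = (1 / real CARD('m)) * (u \<bullet> (diag_mat (\<gamma> k) *v \<nu>))"

lemma \<alpha>_le: "\<alpha> k \<le> norm u * norm \<nu> * gam k"
proof -
  have "norm (diag_mat (\<gamma> k) *v \<nu>) \<le> norm (gam k *\<^sub>R \<nu>)"
  proof (rule norm_le_componentwise_cart)
    fix i
    show "norm ((diag_mat (\<gamma> k) *v \<nu>) $ i) \<le> norm ((gam k *\<^sub>R \<nu>) $ i)"
      using \<gamma>_nonneg[of k i] max_step_ge[of "\<gamma> k" i] gam_pos[of k]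
      by (simp add: diag_mat_mult_vec_nth gam_def abs_mult mult_right_mono)
  qed
  then have "norm u * norm (diag_mat (\<gamma> k) *v \<nu>) \<le> norm u * (gam k * norm \<nu>)"
    using gam_pos[of k] by (intro mult_left_mono) auto
  then have "\<bar>u \<bullet> (diag_mat (\<gamma> k) *v \<nu>)\<bar> \<le> norm u * (gam k * norm \<nu>)"
    using Cauchy_Schwarz_ineq2 order_trans by blast
  moreover have "\<bar>\<alpha> k\<bar> \<le> 1 * \<bar>u \<bullet> (diag_mat (\<gamma> k) *v \<nu>)\<bar>"
    unfolding \<alpha>_def abs_mult by (intro mult_right_mono) (auto simp: Suc_leI)
  ultimately show ?thesis
    by (simp add: mult_ac)
qed

text \<open>On the part \<open>outer \<nu> (ybar k)\<close> of \<open>y k\<close>, the unequal steps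
  of the agents act as the single step \<open>\<alpha> k\<close>; the rest is tracking
  error.\<close>

lemma xbar_Suc:
  "xbar (Suc k) = xbar k - \<alpha> k *\<^sub>R ybar k
    - weighted_avg u (diag_mat (\<gamma> k) ** (y k - outer \<nu> (ybar k)))"
proof -
  have "weighted_avg u (diag_mat (\<gamma> k) ** outer \<nu> (ybar k)) = \<alpha> k *\<^sub>R ybar k"
    by (simp add: matrix_mult_outer weighted_avg_outer \<alpha>_def)
  then show ?thesis
    by (simp add: xbar_Suc_raw matrix_diff_distrib(1) weighted_avg_linear)
qed

text \<open>
  Since \<open>b < a\<close>, eventually \<open>\<alpha> k * M\<^sup>2\<close> is below the modulus \<open>lam k * \<mu>\<close> of the regularised objective,
  so strong monotonicity and Lipschitz continuity alone make the averaged step a contraction.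
\<close>

lemma t_step:
  obtains \<kappa> c where "0 < \<kappa>" "0 \<le> c"
    "\<forall>\<^sub>F k in sequentially. t (Suc k)
      \<le> (1 - \<kappa> * gam k * lam k) * t k + c * gam k * (ex k + ey k) + c / (real k + 1)"
proof -
  obtain \<theta> where \<theta>: "0 < \<theta>" "\<And>k. \<theta> * gam k \<le> \<alpha> k"
    using steps unfolding update_rule_def \<alpha>_def gam_def by blast
  define c\<alpha> where "c\<alpha> = norm u * norm \<nu>"
  have c\<alpha>: "0 \<le> c\<alpha>" "\<alpha> k \<le> c\<alpha> * gam k" for k
    using \<alpha>_le by (auto simp: c\<alpha>_def)
  define c where "c = c\<alpha> * M + norm u + cp"
  have cp: "0 \<le> cp"
    using L \<mu> by (simp add: cp_def)
  have parts: "0 \<le> c\<alpha> * M" "c\<alpha> * M \<le> c" "norm u \<le> c" "cp \<le> c"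
    using c\<alpha>(1) M_nonneg cp by (auto simp: c_def)
  have "(\<lambda>k. (real k + 1) powr - (a - b)) \<longlonglongrightarrow> 0"
    using exponents by real_asymp
  from tendsto_mult_right_zero[OF this] have "\<forall>\<^sub>F k in sequentially. (gam 0 * c\<alpha> * M\<^sup>2 / (lam 0 * \<mu>)) * (real k + 1) powr - (a - b) < 1"
    by (rule order_tendstoD(2)) simp
  then have ev1: "\<forall>\<^sub>F k in sequentially. \<alpha> k * M\<^sup>2 \<le> lam k * \<mu>"
  proof eventually_elim
    case (elim k)
    have "\<alpha> k * M\<^sup>2 \<le> c\<alpha> * gam k * M\<^sup>2"
      using c\<alpha>(2) by (intro mult_right_mono) auto
    also have "\<dots> = lam k * \<mu> * ((gam 0 * c\<alpha> * M\<^sup>2 / (lam 0 * \<mu>)) * (real k + 1) powr - (a - b))"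
      unfolding gam_eq[of k] lam_eq[of k] minus_diff_eq powr_diff using lam0 \<mu>
      by (simp add: divide_simps)
    also have "\<dots> \<le> lam k * \<mu> * 1"
      using elim lam_pos[of k] \<mu> by (intro mult_left_mono) auto
    finally show ?case by simp
  qed
  have "(\<lambda>k. (real k + 1) powr - a) \<longlonglongrightarrow> 0"
    using exponents by real_asymp
  from tendsto_mult_right_zero[OF this] have "\<forall>\<^sub>F k in sequentially. (gam 0 * c\<alpha> * lam 0 * \<mu>) * (real k + 1) powr - a < 1"
    by (rule order_tendstoD(2)) simp
  then have ev2: "\<forall>\<^sub>F k in sequentially. \<alpha> k * (lam k * \<mu>) \<le> 1"
  proof eventually_elim
    case (elim k)
    have "\<alpha> k * (lam k * \<mu>) \<le> (c\<alpha> * gam k) * (lam 0 * \<mu>)"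
      using c\<alpha> gam_pos[of k] lam_pos[of k] lam_le[of k] \<mu> by (intro mult_mono) auto
    also have "\<dots> = (gam 0 * c\<alpha> * lam 0 * \<mu>) * (real k + 1) powr - a"
      unfolding gam_eq[of k] by (simp add: powr_minus field_simps)
    finally show ?case
      using elim by simp
  qed
  have "\<forall>\<^sub>F k in sequentially. t (Suc k)
      \<le> (1 - (\<theta> * \<mu> / 2) * gam k * lam k) * t k + c * gam k * (ex k + ey k) + c / (real k + 1)"
    using ev1 ev2
  proof eventually_elim
    case (elim k)
    let ?G = "G (lam k)" and ?e = "weighted_avg u (diag_mat (\<gamma> k) ** (y k - outer \<nu> (ybar k)))"
    have \<alpha>0: "0 \<le> \<alpha> k"
      using \<theta> gam_pos[of k] by (meson less_imp_le mult_pos_pos order_trans)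
    have "norm ((xbar k - \<alpha> k *\<^sub>R ?G (xbar k)) - (p k - \<alpha> k *\<^sub>R ?G (p k)))
        \<le> (1 - \<alpha> k * (lam k * \<mu>) / 2) * norm (xbar k - p k)"
      using G_mono[of "lam k"] G_lip[OF lam_range[of k]] \<alpha>0 elim lam_range[of k]
      by (intro gradient_step_contraction[where L = M]) auto
    also have "\<dots> \<le> (1 - (\<theta> * \<mu> / 2) * gam k * lam k) * t k"
    proof -
      have "\<theta> * gam k * (lam k * \<mu>) \<le> \<alpha> k * (lam k * \<mu>)"
        using \<theta>(2) lam_pos[of k] \<mu> by (intro mult_right_mono) auto
      then show ?thesis
        unfolding t_def by (intro mult_right_mono) (auto simp: mult_ac)
    qed
    finally have 1: "norm (xbar k - \<alpha> k *\<^sub>R ?G (xbar k) - p k) \<le> (1 - (\<theta> * \<mu> / 2) * gam k * lam k) * t k"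
      by (simp add: G_p)
    have 2: "norm (\<alpha> k *\<^sub>R (ybar k - ?G (xbar k))) \<le> c * gam k * ex k"
    proof -
      have "norm (\<alpha> k *\<^sub>R (ybar k - ?G (xbar k))) \<le> (c\<alpha> * gam k) * (M * ex k)"
        using \<alpha>0 c\<alpha> gam_pos[of k] ybar_G[of k] by (auto intro!: mult_mono)
      also have "\<dots> = (c\<alpha> * M) * (gam k * ex k)"
        by simp
      also have "\<dots> \<le> c * (gam k * ex k)"
        using parts gam_pos[of k] ex_nonneg[of k] by (intro mult_right_mono) auto
      finally show ?thesis
        by (simp add: mult.assoc)
    qed
    have 3: "norm ?e \<le> c * gam k * ey k"
    proof -
      have "norm (diag_mat (\<gamma> k) ** (y k - outer \<nu> (ybar k))) \<le> gam k * norm (y k - outer \<nu> (ybar k))"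
        unfolding gam_def by (rule norm_diag_mat_mult_le) (rule \<gamma>_nonneg)
      also have "\<dots> \<le> gam k * ey k"
        using gam_pos[of k] norm_y_dev by (intro mult_left_mono) auto
      finally have "norm u * norm (diag_mat (\<gamma> k) ** (y k - outer \<nu> (ybar k))) \<le> norm u * (gam k * ey k)"
        by (rule mult_left_mono) simp
      then have "norm ?e \<le> norm u * (gam k * ey k)"
        using norm_weighted_avg_le order_trans by blast
      also have "\<dots> \<le> c * (gam k * ey k)"
        using parts gam_pos[of k] ey_nonneg[of k] by (intro mult_right_mono) auto
      finally show ?thesis
        by (simp add: mult.assoc)
    qed
    have 4: "norm (p (Suc k) - p k) \<le> c / (real k + 1)"
      using p_drift[of k] divide_right_mono[OF parts(4), of "real k + 1"] by linarith
    \<comment> \<open>Four contributions: contraction towards \<open>p k\<close>, the gradient at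
      the average replaced by \<open>ybar k\<close>, the tracking error, and the drift of
      \<open>p\<close>.\<close>
    let ?A = "xbar k - \<alpha> k *\<^sub>R ?G (xbar k) - p k" and ?B = "\<alpha> k *\<^sub>R (ybar k - ?G (xbar k))"
      and ?C = "p (Suc k) - p k"
    have eq: "xbar (Suc k) - p (Suc k) = ?A - ?B - ?e - ?C"
      by (simp add: xbar_Suc algebra_simps)
    have "t (Suc k) \<le> norm ?A + norm ?B + norm ?e + norm ?C"
      unfolding t_def eq using norm_triangle_ineq4[of "?A - ?B - ?e" ?C]
        norm_triangle_ineq4[of "?A - ?B" ?e] norm_triangle_ineq4[of ?A ?B] by linarith
    with 1 2 3 4 show ?case
      by (simp add: distrib_left)
  qed
  then show ?thesis
    using \<theta> \<mu> parts by (intro that[of "\<theta> * \<mu> / 2" c]) auto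
qed

theorem tracking_rates:
  "\<exists>B\<ge>0. \<forall>\<^sub>F k in sequentially. ex k \<le> B * (real k + 1) powr - (1 - a - b)
    \<and> ey k \<le> B * (real k + 1) powr - (1 - a - b) \<and> t k \<le> B * (real k + 1) powr - (1 - a - b)"
proof -
  obtain c1 where c1: "0 \<le> c1"
    "\<And>k. norm (H (lam (Suc k)) (x (Suc k)) - H (lam k) (x k))
      \<le> c1 * ex k + c1 * gam k * (ex k + ey k + t k) + c1 / (real k + 1)"
    by (rule drift_bound, rule that)
  obtain \<kappa> c2 where c2: "0 < \<kappa>" "0 \<le> c2"
    "\<forall>\<^sub>F k in sequentially. t (Suc k)
      \<le> (1 - \<kappa> * gam k * lam k) * t k + c2 * gam k * (ex k + ey k) + c2 / (real k + 1)"
    by (rule t_step, rule that)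
  define c3 where "c3 = cN * (1 + norm \<nu>) * c1"
  define c where "c = cN * cy + c3 + c2"
  have parts: "0 \<le> cN * cy" "0 \<le> c3" "0 \<le> c2" "cN * cy \<le> c" "c3 \<le> c" "c2 \<le> c"
    using cN cy_nonneg c1(1) c2(2) by (auto simp: c3_def c_def)
  have S: "0 \<le> gam k * (ex k + ey k + t k)" "0 \<le> gam k * (ex k + ey k)" for k
    using ex_nonneg[of k] ey_nonneg[of k] t_nonneg[of k] gam_pos[of k] by auto
  show ?thesis
  proof (rule coupled_rates[where \<sigma> = \<sigma> and \<kappa> = \<kappa> and c = c and gam = gam and lam = lam
        and ?\<gamma>0.0 = "gam 0" and ?l0.0 = "lam 0"])
    fix k
    show "ex (Suc k) \<le> \<sigma> * ex k + c * gam k * (ex k + ey k + t k)"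
      using ex_step[of k] mult_right_mono[OF parts(4) S(1)[of k]] by (simp add: mult.assoc)
    have "cN * (1 + norm \<nu>) * norm (H (lam (Suc k)) (x (Suc k)) - H (lam k) (x k))
        \<le> cN * (1 + norm \<nu>) * (c1 * ex k + c1 * gam k * (ex k + ey k + t k) + c1 / (real k + 1))"
      using c1(2) cN by (intro mult_left_mono) auto
    also have "\<dots> = c3 * ex k + c3 * (gam k * (ex k + ey k + t k)) + c3 * (1 / (real k + 1))"
      by (simp add: c3_def divide_inverse algebra_simps)
    also have "\<dots> \<le> c * ex k + c * (gam k * (ex k + ey k + t k)) + c * (1 / (real k + 1))"
      using parts(5) S(1) ex_nonneg by (intro add_mono mult_right_mono) auto
    finally show "ey (Suc k) \<le> \<sigma> * ey k + c * ex k + c * gam k * (ex k + ey k + t k) + c / (real k + 1)"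
      using ey_step[of k] by (simp add: mult.assoc)
  next
    show "\<forall>\<^sub>F k in sequentially. t (Suc k)
        \<le> (1 - \<kappa> * gam k * lam k) * t k + c * gam k * (ex k + ey k) + c / (real k + 1)"
      using c2(3)
    proof eventually_elim
      case (elim k)
      then show ?case
        using mult_right_mono[OF parts(6) S(2)[of k]]
          divide_right_mono[OF parts(6), of "real k + 1"]
        by (simp add: mult.assoc)
    qed
  next
    show "0 \<le> c"
      using parts by linarith
  qed (fact exponents \<sigma> gam0 lam0 c2(1) gam_eq lam_eq ex_nonneg ey_nonneg t_nonneg)+
qed

text \<open>Let \<open>h\<close> be the sum of \<open>g i + lam k * f i\<close>. Then
  \<open>h (p k) \<le> h xs\<close>, and the tangent of \<open>h\<close> at \<open>z\<close> bounds
  \<open>h z - h (p k)\<close> by \<open>D z \<bullet> (z - p k)\<close>, which is quadratic in the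
  distance because \<open>D\<close> vanishes at \<open>p k\<close>. The number of agents appears
  because \<open>G\<close> is a mean.\<close>

lemma value_gap:
  assumes f: "\<And>i z. GDERIV (f i) z :> gradient (f i) z"
    and g: "\<And>i z. GDERIV (g i) z :> gradient (g i) z" and g0: "\<And>i. g i xs = 0"
  shows "lam k * ((\<Sum>i\<in>UNIV. f i z) - (\<Sum>i\<in>UNIV. f i xs)) + (\<Sum>i\<in>UNIV. g i z)
    \<le> real CARD('m) * M * (norm (z - p k))\<^sup>2"
proof -
  define h where "h z = (\<Sum>i\<in>UNIV. g i z + lam k * f i z)" for z
  define D where "D z = real CARD('m) *\<^sub>R G (lam k) z" for z
  have D: "GDERIV h z :> D z" for z
  proof -
    have "GDERIV (\<lambda>z. g i z + lam k * f i z) z :> gradient (g i) z + lam k *\<^sub>R gradient (f i) z" for i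
    proof -
      have "GDERIV (\<lambda>z. lam k * f i z) z :> lam k *\<^sub>R gradient (f i) z + f i z *\<^sub>R 0"
        by (intro GDERIV_mult GDERIV_const f)
      then show ?thesis
        using GDERIV_add[OF g[of i z]] by simp
    qed
    then have "GDERIV h z :> (\<Sum>i\<in>UNIV. gradient (g i) z + lam k *\<^sub>R gradient (f i) z)"
      unfolding h_def by (rule GDERIV_sum)
    then show ?thesis
      by (simp add: D_def G_eq weighted_avg_eq_sum H_def row_gradients_def)
  qed
  have mono: "0 * (norm (z - w))\<^sup>2 \<le> (D z - D w) \<bullet> (z - w)" for z w
  proof -
    have "0 \<le> (G (lam k) z - G (lam k) w) \<bullet> (z - w)"
      using G_mono[of "lam k" z w] lam_pos[of k] \<mu>
      by (meson less_imp_le mult_nonneg_nonneg order_trans zero_le_power2)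
    moreover have "(D z - D w) \<bullet> (z - w) = real CARD('m) * ((G (lam k) z - G (lam k) w) \<bullet> (z - w))"
      by (simp add: D_def flip: scaleR_diff_right)
    ultimately show ?thesis
      by simp
  qed
  note lower = strongly_monotone_gradient_lower_bound[of h D 0, OF D mono, simplified]
  have "h (p k) \<le> h xs"
    using lower[of "p k" xs] by (simp add: D_def G_p)
  moreover have "h z - h (p k) \<le> D z \<bullet> (z - p k)"
    using lower[of z "p k"] by (simp add: inner_diff_right)
  moreover have "D z \<bullet> (z - p k) \<le> real CARD('m) * M * (norm (z - p k))\<^sup>2"
  proof -
    have "D z \<bullet> (z - p k) \<le> norm (D z) * norm (z - p k)"
      by (rule norm_cauchy_schwarz)
    also have "\<dots> \<le> (real CARD('m) * (M * norm (z - p k))) * norm (z - p k)"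
      using G_lip[OF lam_range[of k], of z "p k"] by (intro mult_right_mono) (auto simp: D_def G_p)
    finally show ?thesis
      by (simp add: power2_eq_square mult.assoc)
  qed
  ultimately have "h z - h xs \<le> real CARD('m) * M * (norm (z - p k))\<^sup>2"
    by linarith
  then show ?thesis
    by (simp add: h_def g0 sum.distrib right_diff_distrib flip: sum_distrib_left)
qed

text \<open>Serves twice: at \<open>xs\<close> it limits how far values can fall below the optimum,
  and at a midpoint it shows that the minimiser is unique.\<close>

lemma objective_lower_bound:
  assumes f: "\<And>i z. GDERIV (f i) z :> gradient (f i) z"
  shows "(\<Sum>i\<in>UNIV. f i z) + real CARD('m) * (Gf z \<bullet> (w - z) + \<mu> / 2 * (norm (w - z))\<^sup>2)
    \<le> (\<Sum>i\<in>UNIV. f i w)"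
proof -
  have "(\<Sum>i\<in>UNIV. f i z + gradient (f i) z \<bullet> (w - z) + \<mu> / 2 * (norm (w - z))\<^sup>2) \<le> (\<Sum>i\<in>UNIV. f i w)"
    by (intro sum_mono strongly_monotone_gradient_lower_bound f f_mono)
  moreover have "real CARD('m) * (Gf z \<bullet> (w - z)) = (\<Sum>i\<in>UNIV. gradient (f i) z \<bullet> (w - z))"
    by (simp add: Gf_def inner_weighted_avg_one)
  ultimately show ?thesis
    by (simp add: sum.distrib distrib_left)
qed

end

section \<open>Convergence rates\<close>

text \<open>Positivity of the second exponent in \<open>update_rule\<close> forces
  \<open>\<epsilon> < 3 / 5\<close>, the sense in which \<open>\<epsilon>\<close> is small. The
  objective estimate is an upper bound because the averages may be infeasible and the difference
  negative.\<close>

theorem corollary1: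
  fixes f :: "'m::finite \<Rightarrow> real^'n \<Rightarrow> real"
    and d :: "'m \<Rightarrow> nat" and A :: "'m \<Rightarrow> nat \<Rightarrow> real^'n" and b :: "'m \<Rightarrow> nat \<Rightarrow> real"
    and J :: "'n set" and xstar :: "real^'n"
    and R C :: "real^'m^'m" and u \<nu> :: "real^'m"
    and NR NC :: "real^'m \<Rightarrow> real"
    and \<gamma> :: "nat \<Rightarrow> real^'m" and lam :: "nat \<Rightarrow> real"
    and x y :: "nat \<Rightarrow> real^'n^'m"
    and \<mu>f Lf \<epsilon> :: real
  defines "F \<equiv> \<lambda>z. \<Sum>i\<in>UNIV. f i z"
    and "xbar \<equiv> \<lambda>k. weighted_avg u (x k)"
    and "ybar \<equiv> \<lambda>k. weighted_avg 1 (y k)"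
  assumes "\<mu>f > 0" and "Lf > 0"
    and "\<And>i. strongly_convex \<mu>f (f i)" and "\<And>i. L_smooth Lf (f i)"
    and "feasible_set d A b J \<noteq> {}"
    and "is_arg_min F (\<lambda>z. z \<in> feasible_set d A b J) xstar"
    and "mixing_matrices R C" and "left_eigvec R u" and "right_eigvec C \<nu>"
    and "vector_norm NR" and "vector_norm NC"
    and "induced_norm NR (R - (1 / real CARD('m)) *\<^sub>R outer 1 u) < 1"
    and "induced_norm NC (C - (1 / real CARD('m)) *\<^sub>R outer \<nu> 1) < 1"
    and "\<And>W :: real^'n^'m. ext_norm norm W \<le> ext_norm NR W"
    and "\<And>W :: real^'n^'m. ext_norm norm W \<le> ext_norm NC W"
    and "\<epsilon> > 0" and "update_rule u \<nu> (1 / 5) (1 / 5 - \<epsilon> / 3) \<gamma> lam"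
    and "push_pull R C f (penalty d A b J) \<gamma> lam x y"
  shows "xbar \<longlonglongrightarrow> xstar
    \<and> (\<lambda>k. ext_norm NR (x (k + 1) - outer 1 (xbar (k + 1))))
        \<in> O(\<lambda>k. 1 / real k powr (3 / 5 + \<epsilon> / 3))
    \<and> (\<lambda>k. ext_norm NC (y (k + 1) - outer \<nu> (ybar (k + 1))))
        \<in> O(\<lambda>k. 1 / real k powr (3 / 5 + \<epsilon> / 3))
    \<and> (\<exists>K. \<forall>\<^sub>F k in sequentially. F (xbar k) - F xstar \<le> K * (1 / real k powr (1 - \<epsilon>)))
    \<and> (\<lambda>k. (stacked_residual d A b (xbar k))\<^sup>2) \<in> O(\<lambda>k. 1 / real k powr (1 / 5 - \<epsilon> / 3))"
proof -
  let ?g = "penalty d A b J"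
  have f_mono: "\<mu>f * (norm (z - w))\<^sup>2 \<le> (gradient (f i) z - gradient (f i) w) \<bullet> (z - w)"
    and f_grad: "GDERIV (f i) z :> gradient (f i) z" for i z w
    using assms(6)[of i] by (auto simp: strongly_convex_def intro: GDERIV_gradient)
  have f_lip: "norm (gradient (f i) z - gradient (f i) w) \<le> Lf * norm (z - w)" for i z w
    using assms(7)[of i] by (auto simp: L_smooth_def)
  have "\<exists>c\<ge>0. (\<forall>z. GDERIV (?g i) z :> gradient (?g i) z) \<and>
      (\<forall>y z. 0 \<le> (gradient (?g i) y - gradient (?g i) z) \<bullet> (y - z)) \<and>
      (\<forall>y z. norm (gradient (?g i) y - gradient (?g i) z) \<le> c * norm (y - z)) \<and>
      (\<forall>z\<in>feasible_set d A b J. gradient (?g i) z = 0)" for i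
    by (rule penalty_gradient[of d A b J i]) blast
  then obtain cg where cg: "\<And>i. 0 \<le> cg i"
    "\<And>i z. GDERIV (?g i) z :> gradient (?g i) z"
    "\<And>i y z. 0 \<le> (gradient (?g i) y - gradient (?g i) z) \<bullet> (y - z)"
    "\<And>i y z. norm (gradient (?g i) y - gradient (?g i) z) \<le> cg i * norm (y - z)"
    "\<And>i z. z \<in> feasible_set d A b J \<Longrightarrow> gradient (?g i) z = 0"
    by metis
  define L where "L = Lf + (\<Sum>i\<in>UNIV. cg i)"
  have L: "Lf \<le> L" "cg i \<le> L" for i
  proof -
    have "0 \<le> sum cg UNIV" "cg i \<le> sum cg UNIV"
      using cg(1) by (auto intro!: sum_nonneg member_le_sum)
    then show "Lf \<le> L" "cg i \<le> L"
      using assms(5) unfolding L_def by linarith+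
  qed
  have xstar: "xstar \<in> feasible_set d A b J"
    and opt: "\<And>z. z \<in> feasible_set d A b J \<Longrightarrow> F xstar \<le> F z"
    using assms(9) by (auto simp: is_arg_min_def not_less)
  have normR: "norm v \<le> NR v" and normC: "norm v \<le> NC v" for v
    using norm_le_vector_norm[OF assms(13) assms(17)] norm_le_vector_norm[OF assms(14) assms(18)] by auto
  obtain cR where cR: "0 \<le> cR" "\<And>v. NR v \<le> cR * norm v"
    using vector_norm_le_norm[OF assms(13)] by blast
  obtain cC where cC: "0 \<le> cC" "\<And>v. NC v \<le> cC * norm v"
    using vector_norm_le_norm[OF assms(14)] by blast
  let ?SR = "R - (1 / real CARD('m)) *\<^sub>R outer 1 u" and ?SC = "C - (1 / real CARD('m)) *\<^sub>R outer \<nu> 1"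
  define \<sigma> where "\<sigma> = max (induced_norm NR ?SR) (induced_norm NC ?SC)"
  interpret push_pull_tracking R C u \<nu> f ?g NR NC \<gamma> lam x y xstar \<mu>f L \<sigma> "cR + cC" "1 / 5" "1 / 5 - \<epsilon> / 3"
  proof
    show "norm (gradient (f i) z - gradient (f i) w) \<le> L * norm (z - w)" for i z w
      by (rule order_trans[OF f_lip]) (intro mult_right_mono L norm_ge_zero)
    show "norm (gradient (?g i) z - gradient (?g i) w) \<le> L * norm (z - w)" for i z w
      by (rule order_trans[OF cg(4)]) (intro mult_right_mono L norm_ge_zero)
    show "0 \<le> L"
      using L(1) assms(5) by linarith
    show "R *v 1 = 1" "u v* R = u" "u \<bullet> 1 = real CARD('m)" "1 v* C = 1" "C *v \<nu> = \<nu>"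
      "1 \<bullet> \<nu> = real CARD('m)"
      using assms(10-12) by (auto simp: mixing_matrices_def left_eigvec_def right_eigvec_def)
    show "0 \<le> \<sigma>" "\<sigma> < 1"
      using induced_norm_contraction(1)[OF assms(13) normR, of ?SR] assms(15,16) by (auto simp: \<sigma>_def)
    show "ext_norm NR (?SR ** X) \<le> \<sigma> * ext_norm NR X" for X :: "real^'n^'m"
      using induced_norm_contraction(2)[OF assms(13) normR, of ?SR X]
        mult_right_mono[of "induced_norm NR ?SR" \<sigma> "ext_norm NR X"] ext_norm_nonneg[of NR X]
      by (simp add: \<sigma>_def)
    show "ext_norm NC (?SC ** X) \<le> \<sigma> * ext_norm NC X" for X :: "real^'n^'m"
      using induced_norm_contraction(2)[OF assms(14) normC, of ?SC X]
        mult_right_mono[of "induced_norm NC ?SC" \<sigma> "ext_norm NC X"] ext_norm_nonneg[of NC X]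
      by (simp add: \<sigma>_def)
    show "norm X \<le> ext_norm NR X" "norm X \<le> ext_norm NC X" for X :: "real^'n^'m"
      using assms(17)[of X] assms(18)[of X] by (simp_all add: ext_norm_norm)
    have "NR v \<le> (cR + cC) * norm v" "NC v \<le> (cR + cC) * norm v" for v
      using cR cC by (simp_all add: distrib_right add_increasing add_increasing2)
    then show "ext_norm NR X \<le> (cR + cC) * norm X" "ext_norm NC X \<le> (cR + cC) * norm X"
      for X :: "real^'n^'m"
      using ext_norm_mono[OF assms(13), of X "cR + cC" norm X] cR(1) cC(1)
        ext_norm_mono[OF assms(14), of X "cR + cC" norm X]
      by (auto simp: ext_norm_norm)
    show "0 \<le> cR + cC"
      using cR(1) cC(1) by simp
  qed (fact assms(4,13,14,20,21) f_mono cg(3) cg(5)[OF xstar])+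
  let ?m = "real CARD('m)" and ?Q = "\<lambda>z. \<Sum>i\<in>UNIV. ?g i z"
  have loc: "xbar = local.xbar" "ybar = local.ybar"
    by (auto simp: assms(2,3) xbar_def ybar_def)
  have \<epsilon>: "0 < \<epsilon>" "\<epsilon> < 3 / 5"
    using assms(19) exponents by auto
  define r where "r = 3 / 5 + \<epsilon> / 3"
  have r: "0 < r" "1 - 1 / 5 - (1 / 5 - \<epsilon> / 3) = r"
    using \<epsilon> by (auto simp: r_def)
  obtain B where B: "0 \<le> B" "\<forall>\<^sub>F k in sequentially. ex k \<le> B * (real k + 1) powr - r
      \<and> ey k \<le> B * (real k + 1) powr - r \<and> t k \<le> B * (real k + 1) powr - r"
    using tracking_rates unfolding r(2) by blast
  \<comment> \<open>Shifting the index only helps, as the power decreases. The proof restricts to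
    \<open>k > 0\<close> because at 0 the comparison function is \<open>1 / 0 = 0\<close>.\<close>
  have bigo: "(\<lambda>k. e (k + 1)) \<in> O(\<lambda>k. 1 / real k powr (3 / 5 + \<epsilon> / 3))"
    if "\<And>k. 0 \<le> e k" "\<forall>\<^sub>F k in sequentially. e k \<le> B * (real k + 1) powr - r" for e :: "nat \<Rightarrow> real"
  proof (rule bigoI)
    have "\<forall>\<^sub>F k in sequentially. e (k + 1) \<le> B * (real (k + 1) + 1) powr - r"
      by (rule eventually_compose_filterlim[OF that(2) filterlim_add_const_nat_at_top])
    then show "\<forall>\<^sub>F k in sequentially. norm (e (k + 1)) \<le> B * norm (1 / real k powr (3 / 5 + \<epsilon> / 3))"
      using eventually_gt_at_top[of 0]
    proof eventually_elim
      case (elim k)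
      have "(real (k + 1) + 1) powr - r \<le> real k powr - r"
        using elim(2) r(1) by (intro powr_mono2') auto
      then have "B * (real (k + 1) + 1) powr - r \<le> B * real k powr - r"
        using B(1) by (rule mult_left_mono)
      then have "e (k + 1) \<le> B * (1 / real k powr r)"
        using elim(1) unfolding powr_minus_divide by linarith
      then show ?case
        using that(1)[of "k + 1"] unfolding r_def by simp
    qed
  qed
  have a1: "(\<lambda>k. ext_norm NR (x (k + 1) - outer 1 (xbar (k + 1)))) \<in> O(\<lambda>k. 1 / real k powr (3 / 5 + \<epsilon> / 3))"
  proof -
    have "\<forall>\<^sub>F k in sequentially. ex k \<le> B * (real k + 1) powr - r"
      using B(2) by eventually_elim blast
    from bigo[OF ex_nonneg this] show ?thesis
      by (simp only: ex_def loc)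
  qed
  have a2: "(\<lambda>k. ext_norm NC (y (k + 1) - outer \<nu> (ybar (k + 1)))) \<in> O(\<lambda>k. 1 / real k powr (3 / 5 + \<epsilon> / 3))"
  proof -
    have "\<forall>\<^sub>F k in sequentially. ey k \<le> B * (real k + 1) powr - r"
      using B(2) by eventually_elim blast
    from bigo[OF ey_nonneg this] show ?thesis
      by (simp only: ey_def loc)
  qed

  have Q_nonneg: "0 \<le> ?Q z" for z
    using penalty_ge[of d A b _ z J] by (intro sum_nonneg) (meson order_trans zero_le_power2 divide_nonneg_nonneg zero_le_numeral)
  have Q_0: "?Q z = 0 \<longleftrightarrow> z \<in> feasible_set d A b J" for z
  proof -
    have "0 \<le> ?g i z" for i
      using penalty_ge[of d A b i z J] by (meson order_trans zero_le_power2 divide_nonneg_nonneg zero_le_numeral)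
    then show ?thesis
      using penalty_eq_0_iff[of d A b J z] by (simp add: sum_nonneg_eq_0_iff)
  qed
  have gap: "lam k * (F (xbar k) - F xstar) + ?Q (xbar k) \<le> ?m * M * (t k)\<^sup>2" for k
    using value_gap[OF f_grad cg(2), of k "xbar k"] penalty_eq_0_iff[of d A b J xstar] xstar
    by (simp add: assms(1) t_def loc)
  have t2: "\<forall>\<^sub>F k in sequentially. ?m * M * (t k)\<^sup>2 \<le> ?m * M * B\<^sup>2 * (real k + 1) powr - (2 * r)"
    using B(2)
  proof eventually_elim
    case (elim k)
    have "(t k)\<^sup>2 \<le> (B * (real k + 1) powr - r)\<^sup>2"
      using elim t_nonneg by (intro power_mono) auto
    also have "\<dots> = B\<^sup>2 * (real k + 1) powr - (2 * r)"
      by (simp add: power_mult_distrib power2_eq_square[of "_ powr _"] flip: powr_add)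
    finally show ?case
      using M_nonneg by (simp add: mult_left_mono mult.assoc)
  qed
  define K1 where "K1 = ?m * M * B\<^sup>2 / lam 0"
  have K1: "0 \<le> K1"
    using M_nonneg lam0 by (simp add: K1_def)
  \<comment> \<open>Drop the nonnegative penalty from \<open>gap\<close> and divide by
    \<open>lam k\<close>; the exponent is \<open>2 * r\<close> less that of \<open>lam\<close>. The
    sharper form is kept for the convergence proof.\<close>
  have F_upper: "\<forall>\<^sub>F k in sequentially. F (xbar k) - F xstar \<le> K1 * (real k + 1) powr - (1 + \<epsilon>)"
    using t2
  proof eventually_elim
    case (elim k)
    have "lam k * (F (xbar k) - F xstar) \<le> ?m * M * B\<^sup>2 * (real k + 1) powr - (2 * r)"
      using gap[of k] elim Q_nonneg[of "xbar k"] by linarith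
    then have "F (xbar k) - F xstar \<le> ?m * M * B\<^sup>2 * (real k + 1) powr - (2 * r) / lam k"
      using lam_pos[of k] by (simp add: field_simps)
    also have "\<dots> = K1 * ((real k + 1) powr - (2 * r) * (real k + 1) powr (1 / 5 - \<epsilon> / 3))"
      unfolding lam_eq[of k] by (simp add: K1_def)
    also have "(real k + 1) powr - (2 * r) * (real k + 1) powr (1 / 5 - \<epsilon> / 3) = (real k + 1) powr - (1 + \<epsilon>)"
      unfolding powr_add[symmetric] by (rule arg_cong[where f = "(powr) _"]) (simp add: r_def)
    finally show ?case .
  qed
  have b: "\<exists>K. \<forall>\<^sub>F k in sequentially. F (xbar k) - F xstar \<le> K * (1 / real k powr (1 - \<epsilon>))"
  proof (intro exI)
    show "\<forall>\<^sub>F k in sequentially. F (xbar k) - F xstar \<le> K1 * (1 / real k powr (1 - \<epsilon>))"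
      using F_upper eventually_gt_at_top[of 0]
    proof eventually_elim
      case (elim k)
      have "(real k + 1) powr - (1 + \<epsilon>) \<le> (real k + 1) powr - (1 - \<epsilon>)"
        using \<epsilon> by (intro powr_mono) auto
      also have "\<dots> \<le> real k powr - (1 - \<epsilon>)"
        using elim(2) \<epsilon> by (intro powr_mono2') auto
      also have "\<dots> = 1 / real k powr (1 - \<epsilon>)"
        by (rule powr_minus_divide)
      finally show ?case
        using elim(1) mult_left_mono[OF _ K1] order_trans by blast
    qed
  qed

  \<comment> \<open>Eventually \<open>t k \<le> B\<close>, and \<open>p_bound\<close> controls the
    distance from \<open>p k\<close> to \<open>xstar\<close>.\<close>
  define \<rho> where "\<rho> = B + norm (Gf xstar) / \<mu>f"
  have bounded: "\<forall>\<^sub>F k in sequentially. dist (xbar k) xstar \<le> \<rho>"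
    using B(2)
  proof eventually_elim
    case (elim k)
    have "(real k + 1) powr - r \<le> 1"
      using powr_mono[of "- r" 0 "real k + 1"] r(1) by simp
    then have "t k \<le> B"
      using elim mult_left_mono[of "(real k + 1) powr - r" 1 B] B(1) by simp
    then show ?case
      using p_bound[of k] norm_triangle_ineq[of "xbar k - p k" "p k - xstar"]
      by (simp add: dist_norm \<rho>_def t_def loc)
  qed
  \<comment> \<open>The first summand bounds the deficit \<open>F xstar - F (xbar k)\<close> on the
    ball of radius \<open>\<rho>\<close>, with the constant of \<open>lam k\<close>. It sets the
    rate, since the squared error has the larger exponent \<open>2 * r\<close>.\<close>
  define K2 where "K2 = lam 0 * (?m * (norm (Gf xstar) * \<rho>)) + ?m * M * B\<^sup>2"
  have Q_upper: "\<forall>\<^sub>F k in sequentially. ?Q (xbar k) \<le> K2 * (real k + 1) powr - (1 / 5 - \<epsilon> / 3)"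
    using t2 bounded
  proof eventually_elim
    case (elim k)
    have "F xstar + ?m * (Gf xstar \<bullet> (xbar k - xstar) + \<mu>f / 2 * (norm (xbar k - xstar))\<^sup>2) \<le> F (xbar k)"
      using objective_lower_bound[OF f_grad, of xstar "xbar k"] by (simp add: assms(1))
    moreover have "- (norm (Gf xstar) * \<rho>) \<le> Gf xstar \<bullet> (xbar k - xstar) + \<mu>f / 2 * (norm (xbar k - xstar))\<^sup>2"
    proof -
      have "norm (Gf xstar) * norm (xbar k - xstar) \<le> norm (Gf xstar) * \<rho>"
        using elim(2) by (intro mult_left_mono) (auto simp: dist_norm)
      moreover have "0 \<le> \<mu>f / 2 * (norm (xbar k - xstar))\<^sup>2"
        using assms(4) by simp
      ultimately show ?thesis
        using Cauchy_Schwarz_ineq2[of "Gf xstar" "xbar k - xstar"] by linarith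
    qed
    then have "?m * - (norm (Gf xstar) * \<rho>)
        \<le> ?m * (Gf xstar \<bullet> (xbar k - xstar) + \<mu>f / 2 * (norm (xbar k - xstar))\<^sup>2)"
      by (rule mult_left_mono) simp
    ultimately have "F xstar - F (xbar k) \<le> ?m * (norm (Gf xstar) * \<rho>)"
      by simp
    then have "lam k * (F xstar - F (xbar k)) \<le> lam k * (?m * (norm (Gf xstar) * \<rho>))"
      using lam_pos[of k] by (intro mult_left_mono) auto
    moreover have "?Q (xbar k) \<le> lam k * (F xstar - F (xbar k)) + ?m * M * (t k)\<^sup>2"
      using gap[of k] by (simp add: algebra_simps)
    ultimately have "?Q (xbar k) \<le> lam k * (?m * (norm (Gf xstar) * \<rho>)) + ?m * M * B\<^sup>2 * (real k + 1) powr - (2 * r)"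
      using elim(1) by linarith
    also have "lam k = lam 0 * (real k + 1) powr - (1 / 5 - \<epsilon> / 3)"
      unfolding powr_minus_divide using lam_eq[of k] by simp
    also have "?m * M * B\<^sup>2 * (real k + 1) powr - (2 * r) \<le> ?m * M * B\<^sup>2 * (real k + 1) powr - (1 / 5 - \<epsilon> / 3)"
      using M_nonneg \<epsilon> by (intro mult_left_mono powr_mono) (auto simp: r_def)
    finally show ?case
      by (simp add: K2_def algebra_simps)
  qed
  have K2_abs: "K2 * (real k + 1) powr s \<le> \<bar>K2\<bar> * (real k + 1) powr s" for k s
    by (intro mult_right_mono) auto
  have c: "(\<lambda>k. (stacked_residual d A b (xbar k))\<^sup>2) \<in> O(\<lambda>k. 1 / real k powr (1 / 5 - \<epsilon> / 3))"
  proof (rule bigoI)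
    show "\<forall>\<^sub>F k in sequentially. norm ((stacked_residual d A b (xbar k))\<^sup>2)
        \<le> (2 * \<bar>K2\<bar>) * norm (1 / real k powr (1 / 5 - \<epsilon> / 3))"
      using Q_upper eventually_gt_at_top[of 0]
    proof eventually_elim
      case (elim k)
      have "(stacked_residual d A b (xbar k))\<^sup>2 \<le> 2 * ?Q (xbar k)"
        unfolding stacked_residual_squared sum_distrib_left
        using penalty_ge[of d A b _ "xbar k" J] by (intro sum_mono) (simp add: field_simps)
      also have "\<dots> \<le> 2 * (\<bar>K2\<bar> * (real k + 1) powr - (1 / 5 - \<epsilon> / 3))"
        using order_trans[OF elim(1) K2_abs] by simp
      also have "\<dots> \<le> 2 * (\<bar>K2\<bar> * real k powr - (1 / 5 - \<epsilon> / 3))"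
        using elim(2) \<epsilon> by (intro mult_left_mono powr_mono2') auto
      finally show ?case
        unfolding powr_minus_divide by simp
    qed
  qed

  have "xbar \<longlonglongrightarrow> xstar"
  proof (rule tendsto_unique_zero[OF _ _ bounded])
    let ?\<Phi> = "\<lambda>z. ?Q z + max 0 (F z - F xstar)"
    have "continuous_on UNIV h" if "\<And>z. GDERIV h z :> D z" for h :: "real^'n \<Rightarrow> real" and D
      using that unfolding gderiv_def
      by (intro continuous_at_imp_continuous_on ballI) (rule has_derivative_continuous)
    from this[OF f_grad] this[OF cg(2)] have "continuous_on UNIV (f i)" "continuous_on UNIV (?g i)" for i
      by auto
    then show "continuous_on UNIV ?\<Phi>"
      unfolding assms(1) by (intro continuous_intros)
    show "z = xstar" if "?\<Phi> z \<le> 0" for z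
    proof -
      have "?Q z = 0" "F z \<le> F xstar"
        using that Q_nonneg[of z] by (auto simp: max_def split: if_splits)
      then have z: "z \<in> feasible_set d A b J"
        using Q_0 by blast
      \<comment> \<open>The midpoint of two feasible points. The lower bounds at \<open>c\<close>
        towards \<open>z\<close> and towards \<open>xstar\<close> have opposite linear terms; adding
        them and using \<open>F xstar \<le> F c\<close> forces the quadratic term to vanish.\<close>
      define c where "c = (1 / 2) *\<^sub>R (z + xstar)"
      have "c \<in> feasible_set d A b J"
        using z xstar by (auto simp: c_def feasible_set_def inner_add_right)
      then have "F xstar \<le> F c"
        by (rule opt)
      moreover have dc: "xstar - c = - (z - c)"
        by (simp add: c_def vec_eq_iff field_simps)
      have "F c + ?m * (Gf c \<bullet> (z - c) + \<mu>f / 2 * (norm (z - c))\<^sup>2) \<le> F z"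
        "F c + ?m * (Gf c \<bullet> (xstar - c) + \<mu>f / 2 * (norm (xstar - c))\<^sup>2) \<le> F xstar"
        using objective_lower_bound[OF f_grad] by (auto simp: assms(1))
      then have "F c + ?m * (Gf c \<bullet> (z - c)) + ?m * (\<mu>f / 2 * (norm (z - c))\<^sup>2) \<le> F z"
        "F c - ?m * (Gf c \<bullet> (z - c)) + ?m * (\<mu>f / 2 * (norm (z - c))\<^sup>2) \<le> F xstar"
        unfolding dc inner_minus_right norm_minus_cancel by (simp_all only: distrib_left mult_minus_right)
      ultimately have "?m * (\<mu>f / 2 * (norm (z - c))\<^sup>2) \<le> 0"
        using \<open>F z \<le> F xstar\<close> by linarith
      then have "z = c"
        using assms(4) by (simp add: mult_le_0_iff)
      then show ?thesis
        using dc by simp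
    qed
    have "(\<lambda>k. (real k + 1) powr - (1 / 5 - \<epsilon> / 3)) \<longlonglongrightarrow> 0" "(\<lambda>k. (real k + 1) powr - (1 + \<epsilon>)) \<longlonglongrightarrow> 0"
      using exponents(1) \<epsilon> by real_asymp+
    then have "(\<lambda>k. \<bar>K2\<bar> * (real k + 1) powr - (1 / 5 - \<epsilon> / 3) + K1 * (real k + 1) powr - (1 + \<epsilon>)) \<longlonglongrightarrow> 0"
      by (auto intro!: tendsto_add_zero tendsto_mult_right_zero)
    then show "(\<lambda>k. ?\<Phi> (xbar k)) \<longlonglongrightarrow> 0"
    proof (rule Lim_null_comparison[rotated])
      show "\<forall>\<^sub>F k in sequentially. norm (?\<Phi> (xbar k))
          \<le> \<bar>K2\<bar> * (real k + 1) powr - (1 / 5 - \<epsilon> / 3) + K1 * (real k + 1) powr - (1 + \<epsilon>)"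
        using Q_upper F_upper
      proof eventually_elim
        case (elim k)
        have "?Q (xbar k) \<le> \<bar>K2\<bar> * (real k + 1) powr - (1 / 5 - \<epsilon> / 3)"
          using order_trans[OF elim(1) K2_abs] by simp
        moreover have "max 0 (F (xbar k) - F xstar) \<le> K1 * (real k + 1) powr - (1 + \<epsilon>)"
          using elim(2) K1 by simp
        moreover have "norm (?\<Phi> (xbar k)) = ?\<Phi> (xbar k)"
          using Q_nonneg[of "xbar k"] by simp
        ultimately show ?case
          by linarith
      qed
    qed
  qed
  with a1 a2 b c show ?thesis
    by blast
qed

end
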